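(* Let $R$ be an integral domain, let $\mathcal{C},\mathcal{C}',\mathcal{D}$ be additive categories enriched over $\mathrm{Mod}_R$ such that $\mathcal{D}$ admits countable coproducts, let $N\in\mathbb{N}$, $\xi\in R$, and let $F:\mathcal{C}\otimes_{\mathrm{Mod}_R}\mathcal{C}'\to\mathcal{D}$ be an additive $R$-linear functor. If $(\mathcal{D},N,\xi)$ allows the twisted Leibniz rule, then the functor $F_\xi(\_,\_):\mathrm{C}_\infty(\mathcal{C})\otimes_{\mathrm{Mod}_R}\mathrm{C}_\infty(\mathcal{C}')\to\mathrm{C}_\infty(\mathcal{D})$ restricts to a functor $$F_\xi(\_,\_):\mathrm{C}_N(\mathcal{C})\otimes_{\mathrm{Mod}_R}\mathrm{C}_N(\mathcal{C}')\to\mathrm{C}_N(\mathcal{D}).$$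
   Context: For a category $\mathcal{C}$, an $\infty$-complex in $\mathcal{C}$ is a $\mathbb{Z}$-indexed diagram $\cdots\to X^{n-1}\xrightarrow{d_X}X^n\xrightarrow{d_X}X^{n+1}\to\cdots$ with no condition on $d_X$; a morphism $g:X\to Y$ is a family $g^i:X^i\to Y^i$ ($i\in\mathbb{Z}$) commuting with the differentials. These form the category $\mathrm{C}_\infty(\mathcal{C})$. If $\mathcal{C}$ has a zero object, an $N$-complex is an $\infty$-complex with $d_X^N=0$ (every composite of $N$ consecutive differentials is zero); $\mathrm{C}_N(\mathcal{C})$ is the full subcategory of $N$-complexes. For categories $\mathcal{C},\mathcal{C}'$ enriched over $\mathrm{Mod}_R$, the category $\mathcal{C}\otimes_{\mathrm{Mod}_R}\mathcal{C}'$ has objects pairs $(X,Y)$ with $X\in\mathcal{C}$, $Y\in\mathcal{C}'$, and morphism modules $\mathcal{C}(X_1,X_2)\otimes_R\mathcal{C}'(Y_1,Y_2)$. Thus an $R$-linear functor $F$ on it is the same as an $R$-bilinear bifunctor. The functor $F_\xi$: for $X\in\mathrm{C}_\infty(\mathcal{C})$, $Y\in\mathrm{C}_\infty(\mathcal{C}')$, $$F_\xi(X,Y)^n:=\bigoplus_{i+j=n}F(X^i,Y^j),$$ with differential given on summands by $d_{F_\xi(X,Y)}\circ\iota_{i,j}:=\iota_{i+1,j}\circ F(d_X,\mathrm{Id})+\xi^i\,\iota_{i,j+1}\circ F(\mathrm{Id},d_Y)$, where $\iota_{k,l}:F(X^k,Y^l)\to\bigoplus_{i+j=k+l}F(X^i,Y^j)$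 is the canonical inclusion; on morphisms, $F_\xi(f,g)^n:=\bigoplus_{i+j=n}F(f^i,g^j)$. A triple $(\mathcal{D},N,\xi)$, with $\mathcal{D}$ an additive category enriched over $\mathrm{Mod}_R$, $N\in\mathbb{N}$, $\xi\in R$, allows the twisted Leibniz rule if one of the following holds: (i) every morphism $f$ in $\mathcal{D}$ satisfies $pf=0$ for a fixed prime $p$, $\xi=1$ and $N=p^n$ for some $n\in\mathbb{N}$; (ii) $\xi$ is a primitive $N$-th root of unity in $R$ (i.e. $\xi^N=1$ and $\xi^j\ne1$ for $0<j<N$); (iii) every morphism $f$ in $\mathcal{D}$ satisfies $pf=0$ for a fixed prime $p$, $\xi$ is a primitive $k$-th root of unity in $R$, and $N=p^nk$ for some $n\in\mathbb{N}$. *)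

theory Defs
  imports "HOL-Algebra.Module" "HOL-Computational_Algebra.Primes"
begin

section \<open>Modules\<close>

definition linear_map ::
  "('r, 'x) ring_scheme \<Rightarrow> ('r, 'm, 'y) module_scheme \<Rightarrow> ('r, 'n, 'z) module_scheme \<Rightarrow> ('m \<Rightarrow> 'n) \<Rightarrow> bool"
  where "linear_map R M N f \<longleftrightarrow>
    (\<forall>x\<in>carrier M. f x \<in> carrier N) \<and>
    (\<forall>x\<in>carrier M. \<forall>y\<in>carrier M. f (x \<oplus>\<^bsub>M\<^esub> y) = f x \<oplus>\<^bsub>N\<^esub> f y) \<and>
    (\<forall>r\<in>carrier R. \<forall>x\<in>carrier M. f (r \<odot>\<^bsub>M\<^esub> x) = r \<odot>\<^bsub>N\<^esub> f x)"

definition bilinear_map ::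
  "('r, 'x) ring_scheme \<Rightarrow> ('r, 'm, 'y) module_scheme \<Rightarrow> ('r, 'n, 'z) module_scheme
    \<Rightarrow> ('r, 'p, 'w) module_scheme \<Rightarrow> ('m \<Rightarrow> 'n \<Rightarrow> 'p) \<Rightarrow> bool"
  where "bilinear_map R M N P b \<longleftrightarrow>
    (\<forall>x\<in>carrier M. linear_map R N P (\<lambda>y. b x y)) \<and>
    (\<forall>y\<in>carrier N. linear_map R M P (\<lambda>x. b x y))"


section \<open>Categories enriched over the category of modules over a ring\<close>

text \<open>
  Hom-modules are indexed by source and target and need not be disjoint, so composition and
  identities carry the objects as arguments: for \<open>f : X \<rightarrow> Y\<close> and \<open>g : Y \<rightarrow> Z\<close>, the composite
  \<open>g \<circ> f\<close> is \<open>Comp C X Y Z g f\<close>.  The hom-modules are HOL-Algebra modules, whose inherited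
  \<open>mult\<close> and \<open>one\<close> fields play no role.
\<close>

record ('o, 'm, 'r) lincat =
  Obj :: "'o set"
  Hom :: "'o \<Rightarrow> 'o \<Rightarrow> ('r, 'm) module"
  Comp :: "'o \<Rightarrow> 'o \<Rightarrow> 'o \<Rightarrow> 'm \<Rightarrow> 'm \<Rightarrow> 'm"
  Id :: "'o \<Rightarrow> 'm"

text \<open>
  A linear map out of a tensor product of modules is the same as a bilinear map; composition
  \<open>Hom(Y,Z) \<otimes> Hom(X,Y) \<rightarrow> Hom(X,Z)\<close> is rendered in this way.
\<close>

locale linear_category =
  fixes R :: "('r, 'x) ring_scheme" and C :: "('o, 'm, 'r) lincat"
  assumes hom_module: "X \<in> Obj C \<Longrightarrow> Y \<in> Obj C \<Longrightarrow> module R (Hom C X Y)"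
    and comp_bilinear: "X \<in> Obj C \<Longrightarrow> Y \<in> Obj C \<Longrightarrow> Z \<in> Obj C \<Longrightarrow>
      bilinear_map R (Hom C Y Z) (Hom C X Y) (Hom C X Z) (Comp C X Y Z)"
    and comp_assoc: "W \<in> Obj C \<Longrightarrow> X \<in> Obj C \<Longrightarrow> Y \<in> Obj C \<Longrightarrow> Z \<in> Obj C \<Longrightarrow>
      f \<in> carrier (Hom C W X) \<Longrightarrow> g \<in> carrier (Hom C X Y) \<Longrightarrow> h \<in> carrier (Hom C Y Z) \<Longrightarrow>
      Comp C W Y Z h (Comp C W X Y g f) = Comp C W X Z (Comp C X Y Z h g) f"
    and id_closed: "X \<in> Obj C \<Longrightarrow> Id C X \<in> carrier (Hom C X X)"
    and id_left: "X \<in> Obj C \<Longrightarrow> Y \<in> Obj C \<Longrightarrow> f \<in> carrier (Hom C X Y) \<Longrightarrow>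
      Comp C X Y Y (Id C Y) f = f"
    and id_right: "X \<in> Obj C \<Longrightarrow> Y \<in> Obj C \<Longrightarrow> f \<in> carrier (Hom C X Y) \<Longrightarrow>
      Comp C X X Y f (Id C X) = f"

definition zero_object :: "('o, 'm, 'r) lincat \<Rightarrow> 'o \<Rightarrow> bool"
  where "zero_object C Z \<longleftrightarrow> Z \<in> Obj C \<and>
    (\<forall>X\<in>Obj C. (\<exists>!f. f \<in> carrier (Hom C X Z)) \<and> (\<exists>!f. f \<in> carrier (Hom C Z X)))"

definition biproduct ::
  "('o, 'm, 'r) lincat \<Rightarrow> 'o \<Rightarrow> 'o \<Rightarrow> 'o \<Rightarrow> 'm \<Rightarrow> 'm \<Rightarrow> 'm \<Rightarrow> 'm \<Rightarrow> bool"
  where "biproduct C A B P i1 i2 p1 p2 \<longleftrightarrow> P \<in> Obj C \<and>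
    i1 \<in> carrier (Hom C A P) \<and> i2 \<in> carrier (Hom C B P) \<and>
    p1 \<in> carrier (Hom C P A) \<and> p2 \<in> carrier (Hom C P B) \<and>
    Comp C A P A p1 i1 = Id C A \<and> Comp C B P B p2 i2 = Id C B \<and>
    Comp C A P B p2 i1 = \<zero>\<^bsub>Hom C A B\<^esub> \<and> Comp C B P A p1 i2 = \<zero>\<^bsub>Hom C B A\<^esub> \<and>
    Comp C P A P i1 p1 \<oplus>\<^bsub>Hom C P P\<^esub> Comp C P B P i2 p2 = Id C P"

locale additive_linear_category = linear_category R C
  for R :: "('r, 'x) ring_scheme" and C :: "('o, 'm, 'r) lincat" +
  assumes zero_object_exists: "\<exists>Z. zero_object C Z"
    and biproduct_exists: "A \<in> Obj C \<Longrightarrow> B \<in> Obj C \<Longrightarrow>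
      \<exists>P i1 i2 p1 p2. biproduct C A B P i1 i2 p1 p2"


section \<open>Coproducts\<close>

definition is_coproduct ::
  "('o, 'm, 'r) lincat \<Rightarrow> 'i set \<Rightarrow> ('i \<Rightarrow> 'o) \<Rightarrow> 'o \<Rightarrow> ('i \<Rightarrow> 'm) \<Rightarrow> bool"
  where "is_coproduct D I A P \<iota> \<longleftrightarrow> P \<in> Obj D \<and> (\<forall>i\<in>I. \<iota> i \<in> carrier (Hom D (A i) P)) \<and>
    (\<forall>Z\<in>Obj D. \<forall>f. (\<forall>i\<in>I. f i \<in> carrier (Hom D (A i) Z)) \<longrightarrow>
      (\<exists>!h. h \<in> carrier (Hom D P Z) \<and> (\<forall>i\<in>I. Comp D (A i) P Z h (\<iota> i) = f i)))"

text \<open>Every countable index set is in bijection with a set of natural numbers.\<close>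

definition has_countable_coproducts :: "('o, 'm, 'r) lincat \<Rightarrow> bool"
  where "has_countable_coproducts D \<longleftrightarrow>
    (\<forall>(I :: nat set) A. (\<forall>i\<in>I. A i \<in> Obj D) \<longrightarrow> (\<exists>P \<iota>. is_coproduct D I A P \<iota>))"

text \<open>An unspecified choice of coproducts, made once and for all.\<close>

definition chosen_coproduct ::
  "('o, 'm, 'r) lincat \<Rightarrow> 'i set \<Rightarrow> ('i \<Rightarrow> 'o) \<Rightarrow> 'o \<times> ('i \<Rightarrow> 'm)"
  where "chosen_coproduct D I A = (SOME (P, \<iota>). is_coproduct D I A P \<iota>)"

definition coprod :: "('o, 'm, 'r) lincat \<Rightarrow> 'i set \<Rightarrow> ('i \<Rightarrow> 'o) \<Rightarrow> 'o"
  where "coprod D I A = fst (chosen_coproduct D I A)"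

definition incl :: "('o, 'm, 'r) lincat \<Rightarrow> 'i set \<Rightarrow> ('i \<Rightarrow> 'o) \<Rightarrow> 'i \<Rightarrow> 'm"
  where "incl D I A = snd (chosen_coproduct D I A)"

text \<open>The morphism to \<open>Z\<close> with components \<open>f i : A i \<rightarrow> Z\<close>.\<close>

definition copair ::
  "('o, 'm, 'r) lincat \<Rightarrow> 'i set \<Rightarrow> ('i \<Rightarrow> 'o) \<Rightarrow> 'o \<Rightarrow> ('i \<Rightarrow> 'm) \<Rightarrow> 'm"
  where "copair D I A Z f = (THE h. h \<in> carrier (Hom D (coprod D I A) Z) \<and>
    (\<forall>i\<in>I. Comp D (A i) (coprod D I A) Z h (incl D I A i) = f i))"


section \<open>Bifunctors\<close>

text \<open>
  A linear functor on the tensor product of two enriched categories, encoded as a bilinear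
  bifunctor: \<open>FMor F (X1, Y1) (X2, Y2) f g\<close> is the value on the pure tensor \<open>f \<otimes> g\<close> for
  \<open>f : X1 \<rightarrow> X2\<close> and \<open>g : Y1 \<rightarrow> Y2\<close>.  Bilinearity includes additivity.
\<close>

record ('o1, 'm1, 'o2, 'm2, 'o3, 'm3) bifunctor =
  FObj :: "'o1 \<times> 'o2 \<Rightarrow> 'o3"
  FMor :: "'o1 \<times> 'o2 \<Rightarrow> 'o1 \<times> 'o2 \<Rightarrow> 'm1 \<Rightarrow> 'm2 \<Rightarrow> 'm3"

locale bilinear_bifunctor =
  C: linear_category R C + C': linear_category R C' + D: linear_category R D
  for R :: "('r, 'x) ring_scheme" and C :: "('o1, 'm1, 'r) lincat"
    and C' :: "('o2, 'm2, 'r) lincat" and D :: "('o3, 'm3, 'r) lincat" +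
  fixes F :: "('o1, 'm1, 'o2, 'm2, 'o3, 'm3) bifunctor"
  assumes F_obj: "X \<in> Obj C \<Longrightarrow> Y \<in> Obj C' \<Longrightarrow> FObj F (X, Y) \<in> Obj D"
    and F_bilinear: "X1 \<in> Obj C \<Longrightarrow> X2 \<in> Obj C \<Longrightarrow> Y1 \<in> Obj C' \<Longrightarrow> Y2 \<in> Obj C' \<Longrightarrow>
      bilinear_map R (Hom C X1 X2) (Hom C' Y1 Y2) (Hom D (FObj F (X1, Y1)) (FObj F (X2, Y2)))
        (FMor F (X1, Y1) (X2, Y2))"
    and F_id: "X \<in> Obj C \<Longrightarrow> Y \<in> Obj C' \<Longrightarrow>
      FMor F (X, Y) (X, Y) (Id C X) (Id C' Y) = Id D (FObj F (X, Y))"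
    and F_comp: "X1 \<in> Obj C \<Longrightarrow> X2 \<in> Obj C \<Longrightarrow> X3 \<in> Obj C \<Longrightarrow>
      Y1 \<in> Obj C' \<Longrightarrow> Y2 \<in> Obj C' \<Longrightarrow> Y3 \<in> Obj C' \<Longrightarrow>
      f \<in> carrier (Hom C X1 X2) \<Longrightarrow> f' \<in> carrier (Hom C X2 X3) \<Longrightarrow>
      g \<in> carrier (Hom C' Y1 Y2) \<Longrightarrow> g' \<in> carrier (Hom C' Y2 Y3) \<Longrightarrow>
      FMor F (X1, Y1) (X3, Y3) (Comp C X1 X2 X3 f' f) (Comp C' Y1 Y2 Y3 g' g) =
        Comp D (FObj F (X1, Y1)) (FObj F (X2, Y2)) (FObj F (X3, Y3))
          (FMor F (X2, Y2) (X3, Y3) f' g') (FMor F (X1, Y1) (X2, Y2) f g)"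


section \<open>The category of complexes without condition on the differential\<close>

record ('o, 'm) diagram =
  Term :: "int \<Rightarrow> 'o"
  Diff :: "int \<Rightarrow> 'm"

definition inf_complex :: "('o, 'm, 'r) lincat \<Rightarrow> ('o, 'm) diagram \<Rightarrow> bool"
  where "inf_complex C X \<longleftrightarrow>
    (\<forall>n. Term X n \<in> Obj C \<and> Diff X n \<in> carrier (Hom C (Term X n) (Term X (n + 1))))"

definition inf_complex_mor ::
  "('o, 'm, 'r) lincat \<Rightarrow> ('o, 'm) diagram \<Rightarrow> ('o, 'm) diagram \<Rightarrow> (int \<Rightarrow> 'm) \<Rightarrow> bool"
  where "inf_complex_mor C X Y g \<longleftrightarrow>
    (\<forall>n. g n \<in> carrier (Hom C (Term X n) (Term Y n)) \<and>
      Comp C (Term X n) (Term X (n + 1)) (Term Y (n + 1)) (g (n + 1)) (Diff X n) =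
      Comp C (Term X n) (Term Y n) (Term Y (n + 1)) (Diff Y n) (g n))"

definition C_inf :: "('o, 'm, 'r) lincat \<Rightarrow> (('o, 'm) diagram, int \<Rightarrow> 'm, 'r) lincat"
  where "C_inf C = \<lparr>
    Obj = {X. inf_complex C X},
    Hom = (\<lambda>X Y. \<lparr>
      carrier = {g. inf_complex_mor C X Y g},
      monoid.mult = undefined,
      one = undefined,
      zero = (\<lambda>n. \<zero>\<^bsub>Hom C (Term X n) (Term Y n)\<^esub>),
      add = (\<lambda>g h n. g n \<oplus>\<^bsub>Hom C (Term X n) (Term Y n)\<^esub> h n),
      smult = (\<lambda>r g n. r \<odot>\<^bsub>Hom C (Term X n) (Term Y n)\<^esub> g n) \<rparr>),
    Comp = (\<lambda>X Y Z g f n. Comp C (Term X n) (Term Y n) (Term Z n) (g n) (f n)),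
    Id = (\<lambda>X n. Id C (Term X n)) \<rparr>"


section \<open>N-complexes\<close>

text \<open>\<open>iterated_diff C X n k\<close> is \<open>d\<^sup>k : X\<^sup>n \<rightarrow> X\<^sup>n\<^sup>+\<^sup>k\<close>.\<close>

primrec iterated_diff :: "('o, 'm, 'r) lincat \<Rightarrow> ('o, 'm) diagram \<Rightarrow> int \<Rightarrow> nat \<Rightarrow> 'm"
  where
    "iterated_diff C X n 0 = Id C (Term X n)"
  | "iterated_diff C X n (Suc k) =
      Comp C (Term X n) (Term X (n + int k)) (Term X (n + int k + 1))
        (Diff X (n + int k)) (iterated_diff C X n k)"

definition C_N :: "nat \<Rightarrow> ('o, 'm, 'r) lincat \<Rightarrow> (('o, 'm) diagram, int \<Rightarrow> 'm, 'r) lincat"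
  where "C_N N C = (C_inf C)\<lparr> Obj := {X \<in> Obj (C_inf C).
    \<forall>n. iterated_diff C X n N = \<zero>\<^bsub>Hom C (Term X n) (Term X (n + int N))\<^esub>} \<rparr>"


section \<open>The twisted tensor product of complexes along a bifunctor\<close>

definition antidiag :: "int \<Rightarrow> (int \<times> int) set"
  where "antidiag n = {(i, j). i + j = n}"

definition F_family ::
  "('o1, 'm1, 'o2, 'm2, 'o3, 'm3) bifunctor \<Rightarrow> ('o1, 'm1) diagram \<Rightarrow> ('o2, 'm2) diagram
    \<Rightarrow> int \<times> int \<Rightarrow> 'o3"
  where "F_family F X Y = (\<lambda>(i, j). FObj F (Term X i, Term Y j))"

text \<open>\<open>F_incl D F X Y k l\<close> is the inclusion of the summand at \<open>(k, l)\<close>.\<close>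

definition F_incl ::
  "('o3, 'm3, 'r) lincat \<Rightarrow> ('o1, 'm1, 'o2, 'm2, 'o3, 'm3) bifunctor
    \<Rightarrow> ('o1, 'm1) diagram \<Rightarrow> ('o2, 'm2) diagram \<Rightarrow> int \<Rightarrow> int \<Rightarrow> 'm3"
  where "F_incl D F X Y k l = incl D (antidiag (k + l)) (F_family F X Y) (k, l)"

text \<open>
  The exponent \<open>i\<close> of \<open>\<xi>\<close> below ranges over all integers; for negative \<open>i\<close> the power is a power
  of the inverse of \<open>\<xi>\<close> in \<open>R\<close>, hence meaningful only for a unit \<open>\<xi>\<close>.
\<close>

definition F_xi_obj ::
  "('r, 'x) ring_scheme \<Rightarrow> 'r \<Rightarrow> ('o1, 'm1, 'r) lincat \<Rightarrow> ('o2, 'm2, 'r) lincat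
    \<Rightarrow> ('o3, 'm3, 'r) lincat \<Rightarrow> ('o1, 'm1, 'o2, 'm2, 'o3, 'm3) bifunctor
    \<Rightarrow> ('o1, 'm1) diagram \<times> ('o2, 'm2) diagram \<Rightarrow> ('o3, 'm3) diagram"
  where "F_xi_obj R \<xi> C C' D F = (\<lambda>(X, Y).
    let A = F_family F X Y; T = (\<lambda>n. coprod D (antidiag n) A) in
    \<lparr> Term = T,
      Diff = (\<lambda>n. copair D (antidiag n) A (T (n + 1)) (\<lambda>(i, j).
        Comp D (A (i, j)) (A (i + 1, j)) (T (n + 1))
          (F_incl D F X Y (i + 1) j)
          (FMor F (Term X i, Term Y j) (Term X (i + 1), Term Y j) (Diff X i) (Id C' (Term Y j)))
        \<oplus>\<^bsub>Hom D (A (i, j)) (T (n + 1))\<^esub>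
        (\<xi> [^]\<^bsub>R\<^esub> i) \<odot>\<^bsub>Hom D (A (i, j)) (T (n + 1))\<^esub>
          Comp D (A (i, j)) (A (i, j + 1)) (T (n + 1))
            (F_incl D F X Y i (j + 1))
            (FMor F (Term X i, Term Y j) (Term X i, Term Y (j + 1)) (Id C (Term X i)) (Diff Y j)))) \<rparr>)"

definition F_xi_mor ::
  "('o3, 'm3, 'r) lincat \<Rightarrow> ('o1, 'm1, 'o2, 'm2, 'o3, 'm3) bifunctor
    \<Rightarrow> ('o1, 'm1) diagram \<times> ('o2, 'm2) diagram \<Rightarrow> ('o1, 'm1) diagram \<times> ('o2, 'm2) diagram
    \<Rightarrow> (int \<Rightarrow> 'm1) \<Rightarrow> (int \<Rightarrow> 'm2) \<Rightarrow> int \<Rightarrow> 'm3"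
  where "F_xi_mor D F = (\<lambda>(X1, Y1) (X2, Y2) f g n.
    let A1 = F_family F X1 Y1; A2 = F_family F X2 Y2; T2 = coprod D (antidiag n) A2 in
    copair D (antidiag n) A1 T2 (\<lambda>(i, j).
      Comp D (A1 (i, j)) (A2 (i, j)) T2
        (F_incl D F X2 Y2 i j)
        (FMor F (Term X1 i, Term Y1 j) (Term X2 i, Term Y2 j) (f i) (g j))))"

definition F_xi ::
  "('r, 'x) ring_scheme \<Rightarrow> 'r \<Rightarrow> ('o1, 'm1, 'r) lincat \<Rightarrow> ('o2, 'm2, 'r) lincat
    \<Rightarrow> ('o3, 'm3, 'r) lincat \<Rightarrow> ('o1, 'm1, 'o2, 'm2, 'o3, 'm3) bifunctor
    \<Rightarrow> (('o1, 'm1) diagram, int \<Rightarrow> 'm1, ('o2, 'm2) diagram, int \<Rightarrow> 'm2,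
        ('o3, 'm3) diagram, int \<Rightarrow> 'm3) bifunctor"
  where "F_xi R \<xi> C C' D F = \<lparr> FObj = F_xi_obj R \<xi> C C' D F, FMor = F_xi_mor D F \<rparr>"


section \<open>The twisted Leibniz rule\<close>

definition primitive_root :: "('r, 'x) ring_scheme \<Rightarrow> nat \<Rightarrow> 'r \<Rightarrow> bool"
  where "primitive_root R N \<xi> \<longleftrightarrow> N > 0 \<and> \<xi> \<in> carrier R \<and> \<xi> [^]\<^bsub>R\<^esub> N = \<one>\<^bsub>R\<^esub> \<and>
    (\<forall>j. 0 < j \<and> j < N \<longrightarrow> \<xi> [^]\<^bsub>R\<^esub> j \<noteq> \<one>\<^bsub>R\<^esub>)"

definition annihilates :: "nat \<Rightarrow> ('o, 'm, 'r) lincat \<Rightarrow> bool"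
  where "annihilates p D \<longleftrightarrow> (\<forall>X\<in>Obj D. \<forall>Y\<in>Obj D. \<forall>f\<in>carrier (Hom D X Y).
    [p] \<cdot>\<^bsub>Hom D X Y\<^esub> f = \<zero>\<^bsub>Hom D X Y\<^esub>)"

definition twisted_Leibniz ::
  "('r, 'x) ring_scheme \<Rightarrow> ('o, 'm, 'r) lincat \<Rightarrow> nat \<Rightarrow> 'r \<Rightarrow> bool"
  where "twisted_Leibniz R D N \<xi> \<longleftrightarrow>
    (\<exists>p. prime p \<and> annihilates p D \<and> \<xi> = \<one>\<^bsub>R\<^esub> \<and> (\<exists>n::nat. N = p ^ n)) \<or>
    primitive_root R N \<xi> \<or>
    (\<exists>p k. prime p \<and> annihilates p D \<and> primitive_root R k \<xi> \<and> (\<exists>n::nat. N = p ^ n * k))"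

end

theory Submission
  imports Defs "HOL-Library.Countable_Set"
begin

text \<open>
  The composite \<open>\<iota>\<^sub>k\<^sub>,\<^sub>l \<circ> F(f, g)\<close> behaves like an elementary tensor \<open>f \<otimes> g\<close>
  of degree \<open>k + l\<close>.  The differential acts on it by the twisted Leibniz rule
  \<open>d(f \<otimes> g) = df \<otimes> g + \<xi>\<^sup>k f \<otimes> dg\<close> (\<open>tensor_Diff_summand\<close>), a pair of chain maps acts by
  \<open>(u, v)(f \<otimes> g) = uf \<otimes> vg\<close> (\<open>F_xi_mor_summand\<close>), and morphisms out of the coproduct agree
  as soon as they agree on the tensors \<open>id \<otimes> id\<close>, which are the inclusions (\<open>tensor_ext\<close>).
  From these three facts the functoriality of \<open>F\<^sub>\<xi>\<close> on all complexes is a comparison of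
  elementary tensors.

  Iterating the Leibniz rule gives a binomial theorem for \<open>\<xi>\<close>-commuting operators
  (\<open>tensor_iterated_diff\<close>): on the summand \<open>(i, j)\<close>, the power \<open>d\<^sup>N\<close> is the sum over
  \<open>m \<le> N\<close> of \<open>\<xi>\<^sup>i\<^sup>(\<^sup>N\<^sup>-\<^sup>m\<^sup>)\<close> times the Gaussian binomial coefficient
  \<open>G(N, m)\<close> at \<open>\<xi>\<close> times \<open>d\<^sup>m \<otimes> d\<^sup>N\<^sup>-\<^sup>m\<close>.  For
  \<open>N\<close>-complexes the terms \<open>m = 0\<close> and \<open>m = N\<close> vanish because they contain \<open>d\<^sup>N\<close> of one of the
  factors, so everything rests on the coefficients \<open>G(N, m)\<close> with \<open>0 < m < N\<close> acting as zero on
  the morphisms of the target category.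

  All three alternatives of the hypothesis say that \<open>\<xi>\<close> is a primitive \<open>k\<close>-th root of
  unity and \<open>N = p\<^sup>e k\<close>, where \<open>p\<close> kills all morphisms unless \<open>e = 0\<close>
  (\<open>twisted_Leibniz_cases\<close>).  In a domain, \<open>G(k, m) = 0\<close> for \<open>0 < m < k\<close>, because
  \<open>(1 - \<xi>\<^sup>m) G(k, m)\<close> is a multiple of \<open>1 - \<xi>\<^sup>k = 0\<close>.  Hence \<open>(x + y)\<^sup>k = x\<^sup>k + y\<^sup>k\<close> for
  \<open>\<xi>\<close>-commuting variables, with \<open>x\<^sup>k\<close> and \<open>y\<^sup>k\<close> commuting, and expanding the \<open>p\<^sup>e\<close>-th power of this
  shows that \<open>G(p\<^sup>e k, m)\<close> is \<open>0\<close> unless \<open>m = ck\<close>, in which case it is the ordinary binomial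
  coefficient of \<open>p\<^sup>e\<close> over \<open>c\<close>.  The latter is divisible by \<open>p\<close> for \<open>0 < c < p\<^sup>e\<close>.
\<close>

section \<open>Gaussian binomial coefficients at roots of unity\<close>

text \<open>
  Among the two Pascal rules, this is the one that counts moving a new operator past \<open>m\<close> copies
  of the other: the summand with unchanged \<open>m\<close> carries \<open>q\<^sup>m\<close>, as in the twisted
  Leibniz rule.
\<close>

primrec gauss_binomial :: "('r, 'x) ring_scheme \<Rightarrow> 'r \<Rightarrow> nat \<Rightarrow> nat \<Rightarrow> 'r"
  where
    "gauss_binomial R q 0 m = (if m = 0 then \<one>\<^bsub>R\<^esub> else \<zero>\<^bsub>R\<^esub>)"
  | "gauss_binomial R q (Suc n) m = (case m of 0 \<Rightarrow> \<one>\<^bsub>R\<^esub>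
      | Suc l \<Rightarrow> gauss_binomial R q n l \<oplus>\<^bsub>R\<^esub> q [^]\<^bsub>R\<^esub> m \<otimes>\<^bsub>R\<^esub> gauss_binomial R q n m)"

context cring
begin

lemma gauss_binomial_closed [simp]:
  "q \<in> carrier R \<Longrightarrow> gauss_binomial R q n m \<in> carrier R"
  by (induction n arbitrary: m) (auto split: nat.split)

lemma gauss_binomial_0 [simp]: "gauss_binomial R q n 0 = \<one>"
  by (cases n) auto

lemma gauss_binomial_eq_0: "q \<in> carrier R \<Longrightarrow> n < m \<Longrightarrow> gauss_binomial R q n m = \<zero>"
  by (induction n arbitrary: m) (auto split: nat.split)

lemma gauss_binomial_self: "q \<in> carrier R \<Longrightarrow> gauss_binomial R q n n = \<one>"
  by (induction n) (auto simp: gauss_binomial_eq_0)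

text \<open>
  Consecutive entries of a row have ratio \<open>(1 - q\<^sup>n\<^sup>-\<^sup>m) / (1 - q\<^sup>m\<^sup>+\<^sup>1)\<close>.  Clearing the
  denominator and multiplying by \<open>q\<^sup>m\<close> removes the difference \<open>n - m\<close>, so that the identity
  holds in every commutative ring and for \<open>m > n\<close> as well.
\<close>

lemma gauss_binomial_ratio:
  assumes q: "q \<in> carrier R"
  shows "q [^] m \<otimes> (\<one> \<ominus> q [^] Suc m) \<otimes> gauss_binomial R q n (Suc m) =
    (q [^] m \<ominus> q [^] n) \<otimes> gauss_binomial R q n m"
proof (induction n arbitrary: m)
  case 0
  then show ?case using q by (cases m) (simp_all add: a_minus_def r_neg)
next
  case (Suc n)
  let ?G = "gauss_binomial R q"
  let ?a = "q [^] m" and ?b = "q [^] n" and ?x = "?G n m" and ?y = "?G n (Suc m)"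
  have cl: "?a \<in> carrier R" "?b \<in> carrier R" "?x \<in> carrier R" "?y \<in> carrier R"
    using q by simp_all
  have IH: "?a \<otimes> (\<one> \<ominus> ?a \<otimes> q) \<otimes> ?y = (?a \<ominus> ?b) \<otimes> ?x"
    using Suc.IH[of m] by simp
  have "?a \<otimes> (\<one> \<ominus> q [^] Suc m) \<otimes> ?G (Suc n) (Suc m)
      = ?a \<otimes> (\<one> \<ominus> ?a \<otimes> q) \<otimes> (?x \<oplus> ?a \<otimes> q \<otimes> ?y)"
    by simp
  also have "\<dots> = ?a \<otimes> (\<one> \<ominus> ?a \<otimes> q) \<otimes> ?x \<oplus> ?a \<otimes> q \<otimes> (?a \<otimes> (\<one> \<ominus> ?a \<otimes> q) \<otimes> ?y)"
    using cl q by algebra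
  also have "\<dots> = ?a \<otimes> (\<one> \<ominus> ?b \<otimes> q) \<otimes> ?x"
    unfolding IH using cl q by algebra
  finally have L: "?a \<otimes> (\<one> \<ominus> q [^] Suc m) \<otimes> ?G (Suc n) (Suc m) = ?a \<otimes> (\<one> \<ominus> ?b \<otimes> q) \<otimes> ?x" .
  show ?case
  proof (cases m)
    case 0
    then show ?thesis using L q by simp
  next
    case m: (Suc l)
    let ?c = "q [^] l" and ?z = "?G n l"
    have cl': "?c \<in> carrier R" "?z \<in> carrier R" using q by simp_all
    have a: "?a = ?c \<otimes> q" using m by simp
    have IH': "?c \<otimes> (\<one> \<ominus> ?a) \<otimes> ?x = (?c \<ominus> ?b) \<otimes> ?z"
      using Suc.IH[of l] m by simp
    have "(?a \<ominus> q [^] Suc n) \<otimes> ?G (Suc n) m = (?c \<otimes> q \<ominus> ?b \<otimes> q) \<otimes> (?z \<oplus> ?a \<otimes> ?x)"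
      using m by simp
    also have "\<dots> = q \<otimes> ((?c \<ominus> ?b) \<otimes> ?z) \<oplus> (?a \<ominus> ?b \<otimes> q) \<otimes> ?a \<otimes> ?x"
      unfolding a using cl cl' q by algebra
    also have "\<dots> = (?c \<otimes> q) \<otimes> (\<one> \<ominus> ?a) \<otimes> ?x \<oplus> (?a \<ominus> ?b \<otimes> q) \<otimes> ?a \<otimes> ?x"
      unfolding IH'[symmetric] using cl cl' q by algebra
    also have "\<dots> = ?a \<otimes> (\<one> \<ominus> ?b \<otimes> q) \<otimes> ?x"
      unfolding a[symmetric] using cl cl' q by algebra
    finally show ?thesis using L by simp
  qed
qed

text \<open>
  If row \<open>k\<close> vanishes in its interior, then \<open>(x + y)\<^sup>k = x\<^sup>k + y\<^sup>k\<close> for \<open>q\<close>-commuting variables,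
  and this is the comparison of coefficients in \<open>(x + y)\<^sup>n\<^sup>+\<^sup>k = (x + y)\<^sup>n (x\<^sup>k + y\<^sup>k)\<close>.  The
  induction over the Pascal rule succeeds because \<open>q\<^sup>m = q\<^sup>m\<^sup>-\<^sup>k\<close>.
\<close>

lemma gauss_binomial_add_period:
  assumes q: "q \<in> carrier R" and qk: "q [^] k = \<one>" and k: "0 < k"
    and van: "\<And>m. 0 < m \<Longrightarrow> m < k \<Longrightarrow> gauss_binomial R q k m = \<zero>"
  shows "gauss_binomial R q (n + k) m =
    gauss_binomial R q n m \<oplus> (if k \<le> m then gauss_binomial R q n (m - k) else \<zero>)"
proof (induction n arbitrary: m)
  case 0
  consider "m = 0" | "0 < m \<and> m < k" | "m = k" | "k < m" by linarith
  then show ?case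
    by cases (use q k van in \<open>auto simp: gauss_binomial_self gauss_binomial_eq_0\<close>)
next
  case (Suc n)
  let ?G = "gauss_binomial R q"
  show ?case
  proof (cases m)
    case 0
    then show ?thesis using k q by simp
  next
    case m: (Suc l)
    consider "k \<le> l" | "m = k" | "m < k" using m by linarith
    then show ?thesis
    proof cases
      case 1
      have "q [^] m = q [^] (m - k) \<otimes> q [^] k" using 1 m q by (simp add: nat_pow_mult)
      then have e: "q [^] m = q [^] (m - k)" using qk q by simp
      have s: "m - k = Suc (l - k)" using 1 m by simp
      have "?G (Suc n + k) m = ?G (n + k) l \<oplus> q [^] m \<otimes> ?G (n + k) m"
        using m by simp
      also have "\<dots> = (?G n l \<oplus> q [^] m \<otimes> ?G n m) \<oplus> (?G n (l - k) \<oplus> q [^] m \<otimes> ?G n (m - k))"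
        using Suc.IH[of l] Suc.IH[of m] 1 m q by (simp add: r_distr a_ac)
      also have "\<dots> = ?G (Suc n) m \<oplus> ?G (Suc n) (m - k)"
      proof -
        have "?G (Suc n) m = ?G n l \<oplus> q [^] m \<otimes> ?G n m"
          by (simp only: m gauss_binomial.simps nat.case)
        moreover have "?G (Suc n) (m - k) = ?G n (l - k) \<oplus> q [^] m \<otimes> ?G n (m - k)"
          unfolding e by (simp only: s gauss_binomial.simps nat.case)
        ultimately show ?thesis by (simp only:)
      qed
      finally show ?thesis using 1 m by simp
    next
      case 2
      have "?G (Suc n + k) m = ?G (n + k) l \<oplus> q [^] m \<otimes> ?G (n + k) m"
        using m by simp
      also have "\<dots> = (?G n l \<oplus> q [^] m \<otimes> ?G n m) \<oplus> q [^] m \<otimes> ?G n 0"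
        using Suc.IH[of l] Suc.IH[of m] 2 m q by (simp add: r_distr a_ac)
      also have "\<dots> = ?G (Suc n) m \<oplus> \<one>"
      proof -
        have "?G (Suc n) m = ?G n l \<oplus> q [^] m \<otimes> ?G n m"
          by (simp only: m gauss_binomial.simps nat.case)
        then show ?thesis using 2 qk by simp
      qed
      finally show ?thesis using 2 by simp
    next
      case 3
      then show ?thesis using Suc.IH[of l] Suc.IH[of m] m q by simp
    qed
  qed
qed

text \<open>
  The case of Lucas' theorem for Gaussian coefficients in which the row is a multiple of the period:
  adding \<open>k\<close> to the row is the ordinary Pascal rule for the quotients by \<open>k\<close>.
\<close>

lemma gauss_binomial_mult_period:
  assumes q: "q \<in> carrier R" and qk: "q [^] k = \<one>" and k: "0 < k"
    and van: "\<And>m. 0 < m \<Longrightarrow> m < k \<Longrightarrow> gauss_binomial R q k m = \<zero>"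
  shows "gauss_binomial R q (a * k) m = (if k dvd m then [(a choose (m div k))] \<cdot> \<one> else \<zero>)"
proof (induction a arbitrary: m)
  case 0
  show ?case using k by (auto simp: dvd_def binomial_eq_0)
next
  case (Suc a)
  have "gauss_binomial R q (a * k + k) m = gauss_binomial R q (a * k) m \<oplus>
     (if k \<le> m then gauss_binomial R q (a * k) (m - k) else \<zero>)"
    by (rule gauss_binomial_add_period[OF assms])
  also have "\<dots> = (if k dvd m then [(Suc a choose (m div k))] \<cdot> \<one> else \<zero>)"
  proof (cases "k \<le> m")
    case True
    then have "m div k = Suc ((m - k) div k)" using k by (simp add: le_div_geq)
    moreover have "k dvd m - k \<longleftrightarrow> k dvd m" using True by (metis dvd_minus_self nat_less_le not_le)
    ultimately show ?thesis using True by (simp add: Suc.IH add.nat_pow_mult add.commute)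
  next
    case False
    then have "k dvd m \<Longrightarrow> m = 0" using k by (auto dest: dvd_imp_le)
    then show ?thesis using False by (auto simp: Suc.IH)
  qed
  finally show ?case by (simp add: add.commute)
qed

end

text \<open>
  The ratio identity turns \<open>(1 - q\<^sup>m) G(k, m)\<close> into a multiple of \<open>1 - q\<^sup>k = 0\<close>; the factor
  \<open>1 - q\<^sup>m\<close> is nonzero for a primitive root and cancels in a domain.
\<close>

lemma (in domain) gauss_binomial_primitive_root:
  assumes root: "primitive_root R k q" and m: "0 < m" "m < k"
  shows "gauss_binomial R q k m = \<zero>"
proof -
  let ?G = "gauss_binomial R q"
  have q: "q \<in> carrier R" and qk: "q [^] k = \<one>" and qm: "q [^] m \<noteq> \<one>"
    using root m by (auto simp: primitive_root_def)
  have "q [^] m \<otimes> q [^] (k - m) = \<one>" using q qk m by (simp add: nat_pow_mult)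
  then have q0: "q [^] m \<noteq> \<zero>" using q by force
  have q1: "\<one> \<ominus> q [^] m \<noteq> \<zero>"
  proof
    assume "\<one> \<ominus> q [^] m = \<zero>"
    moreover have "q [^] m = \<one> \<ominus> (\<one> \<ominus> q [^] m)"
      using q nat_pow_closed[OF q, of m] by algebra
    ultimately show False using qm by (simp add: a_minus_def)
  qed
  obtain l where l: "m = Suc l" using m by (cases m) auto
  obtain n where n: "k = Suc n" using m by (cases k) auto
  let ?a = "q [^] l" and ?x = "?G n l" and ?y = "?G n m" and ?b = "q [^] n"
  have cl: "?a \<in> carrier R" "?x \<in> carrier R" "?y \<in> carrier R" "?b \<in> carrier R"  using q by auto
  have "?a \<otimes> ((\<one> \<ominus> q [^] m) \<otimes> ?G k m)
      = ?a \<otimes> (\<one> \<ominus> ?a \<otimes> q) \<otimes> ?x \<oplus> ?a \<otimes> q \<otimes> (?a \<otimes> (\<one> \<ominus> ?a \<otimes> q) \<otimes> ?y)"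
  proof -
    have "?G k m = ?x \<oplus> ?a \<otimes> q \<otimes> ?y" using l n by simp
    then have "?a \<otimes> ((\<one> \<ominus> q [^] m) \<otimes> ?G k m) = ?a \<otimes> ((\<one> \<ominus> ?a \<otimes> q) \<otimes> (?x \<oplus> ?a \<otimes> q \<otimes> ?y))"
      using l by simp
    also have "\<dots> = ?a \<otimes> (\<one> \<ominus> ?a \<otimes> q) \<otimes> ?x \<oplus> ?a \<otimes> q \<otimes> (?a \<otimes> (\<one> \<ominus> ?a \<otimes> q) \<otimes> ?y)"
      using cl q by algebra
    finally show ?thesis .
  qed
  also have "\<dots> = ?a \<otimes> (\<one> \<ominus> ?a \<otimes> q) \<otimes> ?x \<oplus> ?a \<otimes> q \<otimes> ((?a \<ominus> ?b) \<otimes> ?x)"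
    using gauss_binomial_ratio[OF q, of l n] by (simp add: l)
  also have "\<dots> = ?a \<otimes> (\<one> \<ominus> ?b \<otimes> q) \<otimes> ?x" using cl q by algebra
  also have "?b \<otimes> q = \<one>" using qk n by simp
  also have "?a \<otimes> (\<one> \<ominus> \<one>) \<otimes> ?x = \<zero>" using cl by (simp add: a_minus_def r_neg)
  finally have "?a \<otimes> ((\<one> \<ominus> q [^] m) \<otimes> ?G k m) = \<zero>" .
  moreover have "?a \<noteq> \<zero>" using q0 q by (auto simp: l)
  ultimately show ?thesis using q1 cl q by (metis gauss_binomial_closed integral minus_closed nat_pow_closed one_closed m_closed)
qed

lemma prime_dvd_choose_prime_power:
  fixes p :: nat
  assumes p: "prime p" and c: "0 < c" "c < p ^ n"
  shows "p dvd p ^ n choose c"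
proof (rule ccontr)
  assume "\<not> p dvd p ^ n choose c"
  then have "coprime (p ^ n) (p ^ n choose c)"
    using p by (simp add: prime_imp_coprime)
  moreover have "p ^ n dvd c * (p ^ n choose c)"
    using c by (simp add: times_binomial_minus1_eq)
  ultimately have "p ^ n dvd c" by (simp add: coprime_dvd_mult_left_iff)
  then show False using c by (auto dest: dvd_imp_le)
qed

lemma (in module) smult_nat_multiple:
  assumes x: "x \<in> carrier M" and px: "[p] \<cdot>\<^bsub>M\<^esub> x = \<zero>\<^bsub>M\<^esub>" and c: "p dvd c"
  shows "([(c::nat)] \<cdot>\<^bsub>R\<^esub> \<one>\<^bsub>R\<^esub>) \<odot>\<^bsub>M\<^esub> x = \<zero>\<^bsub>M\<^esub>"
proof -
  have "([(c::nat)] \<cdot>\<^bsub>R\<^esub> \<one>\<^bsub>R\<^esub>) \<odot>\<^bsub>M\<^esub> x = [c] \<cdot>\<^bsub>M\<^esub> x"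
    by (induction c) (simp_all add: x smult_l_distr)
  also have "\<dots> = \<zero>\<^bsub>M\<^esub>"
  proof -
    obtain d where "c = p * d" using c by blast
    then have "[c] \<cdot>\<^bsub>M\<^esub> x = [d] \<cdot>\<^bsub>M\<^esub> ([p] \<cdot>\<^bsub>M\<^esub> x)"
      using x M.add.nat_pow_pow[of x d p] by simp
    then show ?thesis using px by simp
  qed
  finally show ?thesis .
qed

text \<open>
  The vanishing to which the twisted Leibniz condition reduces.  Coefficients with
  \<open>\<not> k dvd m\<close> are zero in the ring itself.  The others are binomial
  coefficients of \<open>p\<^sup>e\<close>, hence multiples of \<open>p\<close>; for \<open>e = 0\<close> no such \<open>m\<close> lies strictly between
  \<open>0\<close> and \<open>k\<close>.
\<close>

lemma (in module) gauss_binomial_smult_eq_0: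
  assumes dom: "domain R" and root: "primitive_root R k q"
    and p: "prime p" and x: "x \<in> carrier M" and px: "e = 0 \<or> [p] \<cdot>\<^bsub>M\<^esub> x = \<zero>\<^bsub>M\<^esub>"
    and m: "0 < m" "m < p ^ e * k"
  shows "gauss_binomial R q (p ^ e * k) m \<odot>\<^bsub>M\<^esub> x = \<zero>\<^bsub>M\<^esub>"
proof -
  have q: "q \<in> carrier R" "q [^] k = \<one>" "0 < k" using root by (auto simp: primitive_root_def)
  have G: "gauss_binomial R q (p ^ e * k) m = (if k dvd m then [(p ^ e choose (m div k))] \<cdot> \<one> else \<zero>)"
    by (rule R.gauss_binomial_mult_period[OF q domain.gauss_binomial_primitive_root[OF dom root]])
  show ?thesis
  proof (cases "k dvd m")
    case True
    then have d: "0 < m div k" "m div k < p ^ e" using m q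
      by (auto simp: dvd_div_eq_0_iff less_mult_imp_div_less)
    then have "e \<noteq> 0" by (cases e) auto
    then show ?thesis
      using smult_nat_multiple[OF x _ prime_dvd_choose_prime_power[OF p d]] px True G by simp
  qed (simp add: G x)
qed

text \<open>
  The three alternatives are one: in the first, \<open>1\<close> is a primitive first root of unity, so \<open>k = 1\<close>;
  in the second, \<open>e = 0\<close>.
\<close>

lemma (in domain) twisted_Leibniz_cases:
  assumes "twisted_Leibniz R D N \<xi>"
  obtains p k e where "prime p" "primitive_root R k \<xi>" "N = p ^ e * k" "e = 0 \<or> annihilates p D"
proof -
  have one: "primitive_root R 1 \<one>" by (auto simp: primitive_root_def)
  from assms consider
    (char) p n where "prime p" "annihilates p D" "\<xi> = \<one>" "N = p ^ n"
    | (root) "primitive_root R N \<xi>"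
    | (mixed) p k n where "prime p" "annihilates p D" "primitive_root R k \<xi>" "N = p ^ n * k"
    unfolding twisted_Leibniz_def by blast
  then show thesis
  proof cases
    case char
    then show thesis using one by (intro that[of p 1 n]) simp_all
  next
    case root
    \<comment> \<open>With \<open>e = 0\<close> any prime will do.\<close>
    then show thesis by (intro that[of 2 N 0]) simp_all
  next
    case mixed
    then show thesis by (intro that[of p k n]) simp_all
  qed
qed

text \<open>
  The inductive step of the twisted binomial theorem: the coefficients
  \<open>c(k, m) = a\<^sup>k\<^sup>-\<^sup>m G(k, m)\<close> satisfy \<open>c(k + 1, m + 1) = c(k, m) + a q\<^sup>m\<^sup>+\<^sup>1 c(k, m + 1)\<close>.  In the
  application \<open>a = \<xi>\<^sup>i\<close>, \<open>q = \<xi>\<close> and \<open>t m\<close> is the tensor \<open>d\<^sup>m \<otimes> d\<^sup>k\<^sup>+\<^sup>1\<^sup>-\<^sup>m\<close>.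
\<close>

lemma (in module) twisted_pascal_sum:
  assumes a: "a \<in> carrier R" and q: "q \<in> carrier R" and t: "\<And>m. m \<le> Suc k \<Longrightarrow> t m \<in> carrier M"
  shows "finsum M (\<lambda>m. (a [^] (k - m) \<otimes> gauss_binomial R q k m) \<odot>\<^bsub>M\<^esub> (t (Suc m) \<oplus>\<^bsub>M\<^esub> (a \<otimes> q [^] m) \<odot>\<^bsub>M\<^esub> t m)) {..k}
    = finsum M (\<lambda>m. (a [^] (Suc k - m) \<otimes> gauss_binomial R q (Suc k) m) \<odot>\<^bsub>M\<^esub> t m) {..Suc k}"
proof -
  let ?G = "gauss_binomial R q"
  let ?u = "\<lambda>m. (a [^] (k - m) \<otimes> ?G k m) \<odot>\<^bsub>M\<^esub> t (Suc m)"
  let ?v = "\<lambda>m. (a [^] (Suc k - m) \<otimes> (q [^] m \<otimes> ?G k m)) \<odot>\<^bsub>M\<^esub> t m"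
  let ?w = "\<lambda>m. (a [^] (Suc k - m) \<otimes> ?G (Suc k) m) \<odot>\<^bsub>M\<^esub> t m"
  note [simp] = a q t
  have step: "(a [^] (k - m) \<otimes> ?G k m) \<odot>\<^bsub>M\<^esub> (t (Suc m) \<oplus>\<^bsub>M\<^esub> (a \<otimes> q [^] m) \<odot>\<^bsub>M\<^esub> t m) = ?u m \<oplus>\<^bsub>M\<^esub> ?v m"
    if "m \<le> k" for m
  proof -
    have "a [^] (Suc k - m) = a [^] (k - m) \<otimes> a" using that by (simp add: Suc_diff_le)
    then have "a [^] (Suc k - m) \<otimes> (q [^] m \<otimes> ?G k m) = (a [^] (k - m) \<otimes> ?G k m) \<otimes> (a \<otimes> q [^] m)"
      by (simp add: R.m_ac)
    then show ?thesis using that by (simp add: smult_r_distr smult_assoc1)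
  qed
  have w: "?w (Suc m) = ?u m \<oplus>\<^bsub>M\<^esub> ?v (Suc m)" if "m \<le> k" for m
  proof -
    have "a [^] (k - m) \<otimes> ?G (Suc k) (Suc m) =
        a [^] (k - m) \<otimes> ?G k m \<oplus> a [^] (k - m) \<otimes> (q [^] Suc m \<otimes> ?G k (Suc m))"
      by (simp add: R.r_distr)
    then show ?thesis using that by (simp add: smult_l_distr del: gauss_binomial.simps nat_pow_Suc)
  qed
  have v_top: "?v (Suc k) = \<zero>\<^bsub>M\<^esub>" by (simp add: R.gauss_binomial_eq_0)
  \<comment> \<open>The sum of the \<open>v m\<close> may be extended by its vanishing top term; shifting it by one then
    aligns it with the sum of the \<open>u m\<close>.\<close>
  have "finsum M (\<lambda>m. (a [^] (k - m) \<otimes> ?G k m) \<odot>\<^bsub>M\<^esub> (t (Suc m) \<oplus>\<^bsub>M\<^esub> (a \<otimes> q [^] m) \<odot>\<^bsub>M\<^esub> t m)) {..k}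
      = finsum M (\<lambda>m. ?u m \<oplus>\<^bsub>M\<^esub> ?v m) {..k}"
    by (intro M.finsum_cong') (auto simp: step)
  also have "\<dots> = finsum M ?u {..k} \<oplus>\<^bsub>M\<^esub> finsum M ?v {..k}"
    by (rule M.finsum_addf) auto
  also have "finsum M ?v {..k} = finsum M ?v {..Suc k}"
  proof -
    have "finsum M ?v {..Suc k} = ?v (Suc k) \<oplus>\<^bsub>M\<^esub> finsum M ?v {..k}"
      by (rule M.finsum_Suc) auto
    also have "\<dots> = finsum M ?v {..k}"
      unfolding v_top by (intro M.l_zero M.finsum_closed) auto
    finally show ?thesis by (rule sym)
  qed
  also have "\<dots> = finsum M (\<lambda>m. ?v (Suc m)) {..k} \<oplus>\<^bsub>M\<^esub> ?v 0"
    by (rule M.finsum_Suc2) auto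
  also have "finsum M ?u {..k} \<oplus>\<^bsub>M\<^esub> (finsum M (\<lambda>m. ?v (Suc m)) {..k} \<oplus>\<^bsub>M\<^esub> ?v 0)
      = (finsum M ?u {..k} \<oplus>\<^bsub>M\<^esub> finsum M (\<lambda>m. ?v (Suc m)) {..k}) \<oplus>\<^bsub>M\<^esub> ?v 0"
    by (intro M.a_assoc[symmetric] M.finsum_closed) auto
  also have "finsum M ?u {..k} \<oplus>\<^bsub>M\<^esub> finsum M (\<lambda>m. ?v (Suc m)) {..k}
      = finsum M (\<lambda>m. ?u m \<oplus>\<^bsub>M\<^esub> ?v (Suc m)) {..k}"
    by (rule M.finsum_addf[symmetric]) auto
  also have "\<dots> = finsum M (\<lambda>m. ?w (Suc m)) {..k}"
    by (intro M.finsum_cong') (auto simp only: w atMost_iff Pi_iff, auto simp del: gauss_binomial.simps)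
  also have "?v 0 = ?w 0" by simp
  also have "finsum M (\<lambda>m. ?w (Suc m)) {..k} \<oplus>\<^bsub>M\<^esub> ?w 0 = finsum M ?w {..Suc k}"
    by (rule M.finsum_Suc2[symmetric]) (auto simp del: gauss_binomial.simps)
  finally show ?thesis .
qed

section \<open>Integer powers of units\<close>

lemma (in monoid) Units_nat_pow: "u \<in> Units G \<Longrightarrow> u [^] (n :: nat) \<in> Units G"
  by (induction n) auto

text \<open>
  Splitting off one factor \<open>u\<close> is immediate for exponents \<open>i \<ge> 0\<close>.  For \<open>i = -(n + 1)\<close> it amounts to
  \<open>(u\<^sup>n)\<^sup>-\<^sup>1 = (u\<^sup>n\<^sup>+\<^sup>1)\<^sup>-\<^sup>1 u\<close>, which uses that powers of \<open>u\<close> are units.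
\<close>

lemma (in monoid) int_pow_Suc_unit:
  assumes u: "u \<in> Units G"
  shows "u [^] (i + 1 :: int) = u [^] i \<otimes> u"
proof -
  have uc: "u \<in> carrier G" using u by (rule Units_closed)
  show ?thesis
  proof (cases "0 \<le> i")
    case True
    then have "nat (i + 1) = Suc (nat i)" "\<not> i < 0" "\<not> i + 1 < 0" by simp_all
    then show ?thesis by (simp only: int_pow_def2 if_False nat_pow_Suc)
  next
    case False
    define n where "n = nat (- i) - 1"
    have n: "nat (- i) = Suc n" and n': "nat (- (i + 1)) = n" using False by (simp_all add: n_def)
    have un: "u [^] n \<in> Units G" using u by (rule Units_nat_pow)
    have e: "u [^] Suc n = u \<otimes> u [^] n" by (rule nat_pow_Suc2) (rule uc)
    have uS: "u [^] Suc n \<in> Units G" using u by (rule Units_nat_pow)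
    have "inv (u [^] n) = (inv (u [^] Suc n) \<otimes> u [^] Suc n) \<otimes> inv (u [^] n)"
      by (simp only: Units_l_inv[OF uS] l_one[OF Units_inv_closed[OF un]])
    also have "\<dots> = inv (u [^] Suc n) \<otimes> (u \<otimes> (u [^] n \<otimes> inv (u [^] n)))"
      by (simp only: e m_assoc Units_inv_closed[OF uS, unfolded e] Units_inv_closed[OF un] uc
          Units_closed[OF un] m_closed)
    also have "\<dots> = inv (u [^] Suc n) \<otimes> u"
      by (simp only: Units_r_inv[OF un] r_one[OF uc])
    finally have inv_n: "inv (u [^] n) = inv (u [^] Suc n) \<otimes> u" .
    have "u [^] (i + 1) = inv (u [^] n)"
    proof (cases "i + 1 < 0")
      case True
      then show ?thesis by (simp only: int_pow_def2 n' if_True)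
    next
      case False
      then have "i + 1 = 0" using \<open>\<not> 0 \<le> i\<close> by simp
      moreover from this have "n = 0" using n' by simp
      ultimately show ?thesis by simp
    qed
    also have "\<dots> = u [^] i \<otimes> u" using False by (simp only: inv_n int_pow_def2 n not_le if_True)
    finally show ?thesis .
  qed
qed

lemma (in monoid) int_pow_unit_closed:
  assumes "u \<in> Units G"
  shows "u [^] (i :: int) \<in> carrier G"
  unfolding int_pow_def2
  by (cases "i < 0") (simp_all only: if_True if_False Units_inv_closed Units_closed Units_nat_pow assms not_False_eq_True)

lemma (in monoid) int_pow_add_nat_unit:
  assumes "u \<in> Units G"
  shows "u [^] (i + int m) = u [^] i \<otimes> u [^] m"
proof (induction m)
  case (Suc m)
  have "u [^] (i + int (Suc m)) = u [^] ((i + int m) + 1)" by (simp add: add_ac)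
  also have "\<dots> = u [^] i \<otimes> u [^] Suc m"
    using assms by (subst int_pow_Suc_unit) (simp_all add: Suc.IH m_assoc int_pow_unit_closed Units_closed)
  finally show ?case .
qed (simp add: assms int_pow_unit_closed)

text \<open>
  A root of unity is a unit, so the integer powers of \<open>\<xi>\<close> in the differential are genuine powers.
\<close>

lemma (in ring) primitive_root_unit:
  assumes "primitive_root R k u"
  shows "u \<in> Units R"
proof -
  have u: "u \<in> carrier R" and uk: "u [^] k = \<one>" and k: "0 < k"
    using assms by (auto simp: primitive_root_def)
  obtain l where l: "k = Suc l" using k by (cases k) auto
  have "u [^] l \<otimes> u = \<one>" "u \<otimes> u [^] l = \<one>"
    using uk u unfolding l by (simp_all only: nat_pow_Suc nat_pow_Suc2[symmetric])
  then show ?thesis using u unfolding Units_def by blast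
qed

section \<open>Arithmetic in categories enriched over modules\<close>

lemma linear_map_zero:
  assumes "module R M" "module R N" "linear_map R M N f"
  shows "f \<zero>\<^bsub>M\<^esub> = \<zero>\<^bsub>N\<^esub>"
proof -
  interpret M: module R M by fact
  interpret N: module R N by fact
  have "f (\<zero>\<^bsub>R\<^esub> \<odot>\<^bsub>M\<^esub> \<zero>\<^bsub>M\<^esub>) = \<zero>\<^bsub>R\<^esub> \<odot>\<^bsub>N\<^esub> f \<zero>\<^bsub>M\<^esub>" "f \<zero>\<^bsub>M\<^esub> \<in> carrier N"
    using assms(3) M.M.zero_closed M.R.zero_closed unfolding linear_map_def by blast+
  then show ?thesis by simp
qed

context linear_category
begin

lemma hom_abelian_group: "X \<in> Obj C \<Longrightarrow> Y \<in> Obj C \<Longrightarrow> abelian_group (Hom C X Y)"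
  using hom_module[of X Y] by (simp add: module_def)

lemma comp_closed [simp]:
  "X \<in> Obj C \<Longrightarrow> Y \<in> Obj C \<Longrightarrow> Z \<in> Obj C \<Longrightarrow> g \<in> carrier (Hom C Y Z) \<Longrightarrow>
    f \<in> carrier (Hom C X Y) \<Longrightarrow> Comp C X Y Z g f \<in> carrier (Hom C X Z)"
  using comp_bilinear[of X Y Z] by (auto simp: bilinear_map_def linear_map_def)

lemma comp_add_left:
  "X \<in> Obj C \<Longrightarrow> Y \<in> Obj C \<Longrightarrow> Z \<in> Obj C \<Longrightarrow> g \<in> carrier (Hom C Y Z) \<Longrightarrow>
    g' \<in> carrier (Hom C Y Z) \<Longrightarrow> f \<in> carrier (Hom C X Y) \<Longrightarrow>
    Comp C X Y Z (g \<oplus>\<^bsub>Hom C Y Z\<^esub> g') f = Comp C X Y Z g f \<oplus>\<^bsub>Hom C X Z\<^esub> Comp C X Y Z g' f"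
  using comp_bilinear[of X Y Z] by (auto simp: bilinear_map_def linear_map_def)

lemma comp_add_right:
  "X \<in> Obj C \<Longrightarrow> Y \<in> Obj C \<Longrightarrow> Z \<in> Obj C \<Longrightarrow> g \<in> carrier (Hom C Y Z) \<Longrightarrow>
    f \<in> carrier (Hom C X Y) \<Longrightarrow> f' \<in> carrier (Hom C X Y) \<Longrightarrow>
    Comp C X Y Z g (f \<oplus>\<^bsub>Hom C X Y\<^esub> f') = Comp C X Y Z g f \<oplus>\<^bsub>Hom C X Z\<^esub> Comp C X Y Z g f'"
  using comp_bilinear[of X Y Z] by (auto simp: bilinear_map_def linear_map_def)

lemma comp_smult_left:
  "X \<in> Obj C \<Longrightarrow> Y \<in> Obj C \<Longrightarrow> Z \<in> Obj C \<Longrightarrow> g \<in> carrier (Hom C Y Z) \<Longrightarrow>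
    f \<in> carrier (Hom C X Y) \<Longrightarrow> r \<in> carrier R \<Longrightarrow>
    Comp C X Y Z (r \<odot>\<^bsub>Hom C Y Z\<^esub> g) f = r \<odot>\<^bsub>Hom C X Z\<^esub> Comp C X Y Z g f"
  using comp_bilinear[of X Y Z] by (auto simp: bilinear_map_def linear_map_def)

lemma comp_smult_right:
  "X \<in> Obj C \<Longrightarrow> Y \<in> Obj C \<Longrightarrow> Z \<in> Obj C \<Longrightarrow> g \<in> carrier (Hom C Y Z) \<Longrightarrow>
    f \<in> carrier (Hom C X Y) \<Longrightarrow> r \<in> carrier R \<Longrightarrow>
    Comp C X Y Z g (r \<odot>\<^bsub>Hom C X Y\<^esub> f) = r \<odot>\<^bsub>Hom C X Z\<^esub> Comp C X Y Z g f"
  using comp_bilinear[of X Y Z] by (auto simp: bilinear_map_def linear_map_def)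

lemma zero_closed [simp]:
  "X \<in> Obj C \<Longrightarrow> Y \<in> Obj C \<Longrightarrow> \<zero>\<^bsub>Hom C X Y\<^esub> \<in> carrier (Hom C X Y)"
  by (rule abelian_monoid.zero_closed) (use hom_abelian_group in \<open>simp add: abelian_group_def\<close>)

lemma add_closed [simp]:
  "X \<in> Obj C \<Longrightarrow> Y \<in> Obj C \<Longrightarrow> f \<in> carrier (Hom C X Y) \<Longrightarrow> g \<in> carrier (Hom C X Y) \<Longrightarrow>
    f \<oplus>\<^bsub>Hom C X Y\<^esub> g \<in> carrier (Hom C X Y)"
  by (rule abelian_monoid.a_closed) (use hom_abelian_group in \<open>simp_all add: abelian_group_def\<close>)

lemma smult_closed [simp]:
  "X \<in> Obj C \<Longrightarrow> Y \<in> Obj C \<Longrightarrow> r \<in> carrier R \<Longrightarrow> f \<in> carrier (Hom C X Y) \<Longrightarrow>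
    r \<odot>\<^bsub>Hom C X Y\<^esub> f \<in> carrier (Hom C X Y)"
  by (rule module.smult_closed[OF hom_module])

lemma comp_zero_left [simp]:
  "X \<in> Obj C \<Longrightarrow> Y \<in> Obj C \<Longrightarrow> Z \<in> Obj C \<Longrightarrow> f \<in> carrier (Hom C X Y) \<Longrightarrow>
    Comp C X Y Z \<zero>\<^bsub>Hom C Y Z\<^esub> f = \<zero>\<^bsub>Hom C X Z\<^esub>"
  using comp_bilinear[of X Y Z] linear_map_zero[OF hom_module hom_module, of Y Z X Z]
  by (auto simp: bilinear_map_def)

lemma comp_zero_right [simp]:
  "X \<in> Obj C \<Longrightarrow> Y \<in> Obj C \<Longrightarrow> Z \<in> Obj C \<Longrightarrow> g \<in> carrier (Hom C Y Z) \<Longrightarrow>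
    Comp C X Y Z g \<zero>\<^bsub>Hom C X Y\<^esub> = \<zero>\<^bsub>Hom C X Z\<^esub>"
  using comp_bilinear[of X Y Z] linear_map_zero[OF hom_module hom_module, of X Y X Z]
  by (auto simp: bilinear_map_def)

lemma comp_finsum_right:
  assumes obj: "X \<in> Obj C" "Y \<in> Obj C" "Z \<in> Obj C" and g: "g \<in> carrier (Hom C Y Z)"
    and fin: "finite I" and f: "\<And>i. i \<in> I \<Longrightarrow> f i \<in> carrier (Hom C X Y)"
  shows "Comp C X Y Z g (finsum (Hom C X Y) f I) = finsum (Hom C X Z) (\<lambda>i. Comp C X Y Z g (f i)) I"
proof -
  interpret XY: abelian_group "Hom C X Y" using obj by (simp add: hom_abelian_group)
  interpret XZ: abelian_group "Hom C X Z" using obj by (simp add: hom_abelian_group)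
  show ?thesis using fin f
  proof (induction I rule: finite_induct)
    case (insert i I)
    then show ?case using obj g
      by (simp add: Pi_def XY.finsum_insert XZ.finsum_insert comp_add_right)
  qed (use obj g in simp)
qed

end

section \<open>The category of complexes\<close>

lemma C_inf_Obj [simp]: "X \<in> Obj (C_inf C) \<longleftrightarrow> inf_complex C X"
  by (simp add: C_inf_def)

lemma C_inf_carrier [simp]: "g \<in> carrier (Hom (C_inf C) X Y) \<longleftrightarrow> inf_complex_mor C X Y g"
  by (simp add: C_inf_def)

lemma C_inf_zero [simp]: "\<zero>\<^bsub>Hom (C_inf C) X Y\<^esub> = (\<lambda>n. \<zero>\<^bsub>Hom C (Term X n) (Term Y n)\<^esub>)"
  by (simp add: C_inf_def)

lemma C_inf_add [simp]:
  "g \<oplus>\<^bsub>Hom (C_inf C) X Y\<^esub> h = (\<lambda>n. g n \<oplus>\<^bsub>Hom C (Term X n) (Term Y n)\<^esub> h n)"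
  by (simp add: C_inf_def)

lemma C_inf_smult [simp]:
  "r \<odot>\<^bsub>Hom (C_inf C) X Y\<^esub> g = (\<lambda>n. r \<odot>\<^bsub>Hom C (Term X n) (Term Y n)\<^esub> g n)"
  by (simp add: C_inf_def)

lemma C_inf_Comp [simp]:
  "Comp (C_inf C) X Y Z g f = (\<lambda>n. Comp C (Term X n) (Term Y n) (Term Z n) (g n) (f n))"
  by (simp add: C_inf_def)

lemma C_inf_Id [simp]: "Id (C_inf C) X = (\<lambda>n. Id C (Term X n))"
  by (simp add: C_inf_def)

lemma inf_complex_Term [simp]: "inf_complex C X \<Longrightarrow> Term X n \<in> Obj C"
  by (simp add: inf_complex_def)

lemma inf_complex_Diff [simp]:
  "inf_complex C X \<Longrightarrow> n + 1 = n' \<Longrightarrow> Diff X n \<in> carrier (Hom C (Term X n) (Term X n'))"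
  by (auto simp: inf_complex_def)

lemma inf_complex_mor_closed [simp]:
  "inf_complex_mor C X Y g \<Longrightarrow> g n \<in> carrier (Hom C (Term X n) (Term Y n))"
  by (simp add: inf_complex_mor_def)

context linear_category
begin

lemma chain_map_zero:
  "inf_complex C X \<Longrightarrow> inf_complex C Y \<Longrightarrow>
    inf_complex_mor C X Y (\<lambda>n. \<zero>\<^bsub>Hom C (Term X n) (Term Y n)\<^esub>)"
  by (simp add: inf_complex_mor_def)

lemma chain_map_add:
  assumes "inf_complex C X" "inf_complex C Y" "inf_complex_mor C X Y g" "inf_complex_mor C X Y h"
  shows "inf_complex_mor C X Y (\<lambda>n. g n \<oplus>\<^bsub>Hom C (Term X n) (Term Y n)\<^esub> h n)"
  using assms unfolding inf_complex_mor_def by (simp add: comp_add_left comp_add_right)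

lemma chain_map_smult:
  assumes "inf_complex C X" "inf_complex C Y" "inf_complex_mor C X Y g" "r \<in> carrier R"
  shows "inf_complex_mor C X Y (\<lambda>n. r \<odot>\<^bsub>Hom C (Term X n) (Term Y n)\<^esub> g n)"
  using assms unfolding inf_complex_mor_def by (simp add: comp_smult_left comp_smult_right)

lemma chain_map_id:
  "inf_complex C X \<Longrightarrow> inf_complex_mor C X X (\<lambda>n. Id C (Term X n))"
  by (simp add: inf_complex_mor_def id_closed id_left id_right)

lemma chain_map_comp:
  assumes "inf_complex C X" "inf_complex C Y" "inf_complex C Z"
    and g: "inf_complex_mor C Y Z g" and f: "inf_complex_mor C X Y f"
  shows "inf_complex_mor C X Z (\<lambda>n. Comp C (Term X n) (Term Y n) (Term Z n) (g n) (f n))"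
  unfolding inf_complex_mor_def
proof (intro allI conjI)
  fix n
  let ?X = "Term X" and ?Y = "Term Y" and ?Z = "Term Z"
  note [simp] = assms
  show "Comp C (?X n) (?Y n) (?Z n) (g n) (f n) \<in> carrier (Hom C (?X n) (?Z n))" by simp
  have "Comp C (?X n) (?X (n + 1)) (?Z (n + 1))
      (Comp C (?X (n + 1)) (?Y (n + 1)) (?Z (n + 1)) (g (n + 1)) (f (n + 1))) (Diff X n)
    = Comp C (?X n) (?Y (n + 1)) (?Z (n + 1)) (g (n + 1))
      (Comp C (?X n) (?X (n + 1)) (?Y (n + 1)) (f (n + 1)) (Diff X n))"
    by (simp add: comp_assoc)
  also have "\<dots> = Comp C (?X n) (?Y (n + 1)) (?Z (n + 1)) (g (n + 1))
      (Comp C (?X n) (?Y n) (?Y (n + 1)) (Diff Y n) (f n))"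
    using f by (simp add: inf_complex_mor_def)
  also have "\<dots> = Comp C (?X n) (?Y n) (?Z (n + 1))
      (Comp C (?Y n) (?Y (n + 1)) (?Z (n + 1)) (g (n + 1)) (Diff Y n)) (f n)"
    by (simp add: comp_assoc)
  also have "\<dots> = Comp C (?X n) (?Y n) (?Z (n + 1))
      (Comp C (?Y n) (?Z n) (?Z (n + 1)) (Diff Z n) (g n)) (f n)"
    using g by (simp add: inf_complex_mor_def)
  also have "\<dots> = Comp C (?X n) (?Z n) (?Z (n + 1)) (Diff Z n)
      (Comp C (?X n) (?Y n) (?Z n) (g n) (f n))"
    by (simp add: comp_assoc)
  finally show "Comp C (?X n) (?X (n + 1)) (?Z (n + 1))
      (Comp C (?X (n + 1)) (?Y (n + 1)) (?Z (n + 1)) (g (n + 1)) (f (n + 1))) (Diff X n)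
    = Comp C (?X n) (?Z n) (?Z (n + 1)) (Diff Z n) (Comp C (?X n) (?Y n) (?Z n) (g n) (f n))" .
qed

text \<open>
  The module operations on chain maps are those of the hom-modules, degree by degree.
\<close>

lemma C_inf_hom_module:
  assumes X: "inf_complex C X" and Y: "inf_complex C Y"
  shows "module R (Hom (C_inf C) X Y)"
proof -
  have M: "module R (Hom C (Term X n) (Term Y n))" for n
    using X Y by (simp add: hom_module)
  note A = M[THEN module.axioms(2)]
  note AM = A[THEN abelian_group.axioms(1)]
  note [simp] = X Y
  show ?thesis
  proof (rule moduleI)
    show "cring R" using M by (rule module.axioms)
    show "abelian_group (Hom (C_inf C) X Y)"
    proof (rule abelian_groupI, goal_cases)
      case (1 g h)
      then show ?case by (simp add: chain_map_add)
    next
      case 2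
      show ?case by (simp add: chain_map_zero)
    next
      case (3 f g h)
      then show ?case by (simp add: fun_eq_iff abelian_monoid.a_assoc[OF AM])
    next
      case (4 g h)
      then show ?case by (simp add: fun_eq_iff abelian_monoid.a_comm[OF AM, of "g _" _ "h _"])
    next
      case (5 g)
      then show ?case by (simp add: fun_eq_iff abelian_monoid.l_zero[OF AM])
    next
      case (6 g)
      then have g: "inf_complex_mor C X Y g" by simp
      \<comment> \<open>Negation is scalar multiplication by \<open>-1\<close>, for which compatibility with the
        differentials is known.\<close>
      let ?h = "\<lambda>n. (\<ominus>\<^bsub>R\<^esub> \<one>\<^bsub>R\<^esub>) \<odot>\<^bsub>Hom C (Term X n) (Term Y n)\<^esub> g n"
      interpret R: cring R using M by (rule module.axioms)
      have "?h n \<oplus>\<^bsub>Hom C (Term X n) (Term Y n)\<^esub> g n = \<zero>\<^bsub>Hom C (Term X n) (Term Y n)\<^esub>" for n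
      proof -
        interpret module R "Hom C (Term X n) (Term Y n)" by (rule M)
        show ?thesis using g by (simp add: smult_l_minus M.l_neg)
      qed
      then show ?case using chain_map_smult[OF X Y g, of "\<ominus>\<^bsub>R\<^esub> \<one>\<^bsub>R\<^esub>"]
        by (intro bexI[of _ ?h]) auto
    qed
  qed (simp_all add: chain_map_smult fun_eq_iff module.smult_l_distr[OF M]
        module.smult_r_distr[OF M] module.smult_assoc1[OF M] module.smult_one[OF M])
qed

lemma C_inf_linear_category: "linear_category R (C_inf C)"
proof (rule linear_category.intro, goal_cases)
  case 1 then show ?case by (simp add: C_inf_hom_module)
next
  case 2 then show ?case
    by (auto simp: bilinear_map_def linear_map_def fun_eq_iff chain_map_comp
        comp_add_left comp_add_right comp_smult_left comp_smult_right)
qed (auto simp: fun_eq_iff comp_assoc chain_map_id id_left id_right)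

end

lemma (in linear_category) full_subcategory:
  assumes "S \<subseteq> Obj C"
  shows "linear_category R (C\<lparr>Obj := S\<rparr>)"
  using assms by (intro linear_category.intro)
    (auto simp: hom_module comp_bilinear comp_assoc id_closed id_left id_right subset_iff)

lemma (in linear_category) iterated_diff_closed:
  "inf_complex C X \<Longrightarrow> iterated_diff C X n k \<in> carrier (Hom C (Term X n) (Term X (n + int k)))"
proof (induction k)
  case (Suc k)
  have "n + int (Suc k) = n + int k + 1" by simp
  then show ?case using Suc by (simp only: iterated_diff.simps) simp
qed (simp add: id_closed)

section \<open>Coproducts\<close>

lemma (in linear_category) coproduct_ext:
  assumes P: "is_coproduct C I A P \<iota>" and A: "\<And>i. i \<in> I \<Longrightarrow> A i \<in> Obj C" and Z: "Z \<in> Obj C"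
    and h: "h \<in> carrier (Hom C P Z)" "h' \<in> carrier (Hom C P Z)"
    and eq: "\<And>i. i \<in> I \<Longrightarrow> Comp C (A i) P Z h (\<iota> i) = Comp C (A i) P Z h' (\<iota> i)"
  shows "h = h'"
proof -
  have "\<forall>i\<in>I. Comp C (A i) P Z h (\<iota> i) \<in> carrier (Hom C (A i) Z)"
    using P A Z h by (auto simp: is_coproduct_def)
  with P Z have "\<exists>!k. k \<in> carrier (Hom C P Z) \<and> (\<forall>i\<in>I. Comp C (A i) P Z k (\<iota> i) = Comp C (A i) P Z h (\<iota> i))"
    unfolding is_coproduct_def by (elim conjE) (drule (1) bspec, drule spec, erule (1) mp)
  then show ?thesis using h eq by metis
qed

lemma is_coproduct_reindex:
  assumes b: "bij_betw \<phi> I J" and P: "is_coproduct D J (\<lambda>j. A (inv_into I \<phi> j)) P \<iota>"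
  shows "is_coproduct D I A P (\<iota> \<circ> \<phi>)"
  unfolding is_coproduct_def
proof (intro conjI ballI allI impI)
  have inv: "inv_into I \<phi> (\<phi> i) = i" if "i \<in> I" for i
    using b that by (simp add: bij_betw_def)
  have J: "(\<forall>j\<in>J. Q j) \<longleftrightarrow> (\<forall>i\<in>I. Q (\<phi> i))" for Q
    using b by (auto simp: bij_betw_def)
  show "P \<in> Obj D" using P by (simp add: is_coproduct_def)
  show "(\<iota> \<circ> \<phi>) i \<in> carrier (Hom D (A i) P)" if "i \<in> I" for i
    using P that by (simp add: is_coproduct_def J inv)
  fix Z f
  assume Z: "Z \<in> Obj D" and f: "\<forall>i\<in>I. f i \<in> carrier (Hom D (A i) Z)"
  have "\<forall>j\<in>J. f (inv_into I \<phi> j) \<in> carrier (Hom D (A (inv_into I \<phi> j)) Z)"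
    using f by (simp add: J inv)
  with P Z have "\<exists>!h. h \<in> carrier (Hom D P Z) \<and>
      (\<forall>j\<in>J. Comp D (A (inv_into I \<phi> j)) P Z h (\<iota> j) = f (inv_into I \<phi> j))"
    unfolding is_coproduct_def by (elim conjE) (drule (1) bspec, drule spec, erule (1) mp)
  then show "\<exists>!h. h \<in> carrier (Hom D P Z) \<and> (\<forall>i\<in>I. Comp D (A i) P Z h ((\<iota> \<circ> \<phi>) i) = f i)"
    by (simp add: J inv)
qed

text \<open>
  Countable coproducts are postulated for index sets of natural numbers.  Enumerating \<open>I\<close> gives a
  coproduct over the set of its codes, which is then reindexed by \<open>I\<close>.
\<close>

lemma is_coproduct_coprod:
  assumes D: "has_countable_coproducts D" and I: "countable I" and A: "\<And>i. i \<in> I \<Longrightarrow> A i \<in> Obj D"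
  shows "is_coproduct D I A (coprod D I A) (incl D I A)"
proof -
  define \<phi> where "\<phi> = to_nat_on I"
  have b: "bij_betw \<phi> I (\<phi> ` I)" unfolding \<phi>_def using I by (simp add: inj_on_imp_bij_betw inj_on_to_nat_on)
  have "\<forall>j\<in>\<phi> ` I. A (inv_into I \<phi> j) \<in> Obj D" using A inv_into_into[of _ \<phi> I] by auto
  then obtain P \<iota> where "is_coproduct D (\<phi> ` I) (\<lambda>j. A (inv_into I \<phi> j)) P \<iota>"
    using D[unfolded has_countable_coproducts_def, rule_format, of "\<phi> ` I" "\<lambda>j. A (inv_into I \<phi> j)"]
    by auto
  then have "is_coproduct D I A P (\<iota> \<circ> \<phi>)" by (rule is_coproduct_reindex[OF b])
  then have "\<exists>x. (case x of (P, \<iota>) \<Rightarrow> is_coproduct D I A P \<iota>)"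
    by (intro exI[of _ "(P, \<iota> \<circ> \<phi>)"]) simp
  from someI_ex[OF this] show ?thesis
    unfolding coprod_def incl_def chosen_coproduct_def case_prod_unfold .
qed

lemma
  assumes D: "has_countable_coproducts D" and I: "countable I" and A: "\<And>i. i \<in> I \<Longrightarrow> A i \<in> Obj D"
    and Z: "Z \<in> Obj D" and f: "\<And>i. i \<in> I \<Longrightarrow> f i \<in> carrier (Hom D (A i) Z)"
  shows copair_closed: "copair D I A Z f \<in> carrier (Hom D (coprod D I A) Z)"
    and copair_incl: "i \<in> I \<Longrightarrow> Comp D (A i) (coprod D I A) Z (copair D I A Z f) (incl D I A i) = f i"
proof -
  have "is_coproduct D I A (coprod D I A) (incl D I A)" by (rule is_coproduct_coprod[OF D I A])
  then have "\<exists>!h. h \<in> carrier (Hom D (coprod D I A) Z) \<and>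
      (\<forall>i\<in>I. Comp D (A i) (coprod D I A) Z h (incl D I A i) = f i)"
    using Z f by (simp add: is_coproduct_def)
  from theI'[OF this] show "copair D I A Z f \<in> carrier (Hom D (coprod D I A) Z)"
    and "i \<in> I \<Longrightarrow> Comp D (A i) (coprod D I A) Z (copair D I A Z f) (incl D I A i) = f i"
    by (simp_all add: copair_def)
qed

text \<open>
  Only the components on the index set matter.  This permits replacing the defining components of
  the tensor product, whose targets are right only on the antidiagonal, by well-typed ones.
\<close>

lemma copair_cong:
  assumes "\<And>i. i \<in> I \<Longrightarrow> f i = g i"
  shows "copair D I A Z f = copair D I A Z g"
  using assms by (simp add: copair_def cong: conj_cong)

section \<open>Calculus of elementary tensors\<close>

context bilinear_bifunctor
begin

lemma F_closed [simp]:
  "X1 \<in> Obj C \<Longrightarrow> X2 \<in> Obj C \<Longrightarrow> Y1 \<in> Obj C' \<Longrightarrow> Y2 \<in> Obj C' \<Longrightarrow>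
    f \<in> carrier (Hom C X1 X2) \<Longrightarrow> g \<in> carrier (Hom C' Y1 Y2) \<Longrightarrow>
    FMor F (X1, Y1) (X2, Y2) f g \<in> carrier (Hom D (FObj F (X1, Y1)) (FObj F (X2, Y2)))"
  using F_bilinear[of X1 X2 Y1 Y2] by (auto simp: bilinear_map_def linear_map_def)

end

lemma (in bilinear_bifunctor) restrict:
  assumes "S \<subseteq> Obj C" "S' \<subseteq> Obj C'" "T \<subseteq> Obj D"
    and "\<And>X Y. X \<in> S \<Longrightarrow> Y \<in> S' \<Longrightarrow> FObj F (X, Y) \<in> T"
  shows "bilinear_bifunctor R (C\<lparr>Obj := S\<rparr>) (C'\<lparr>Obj := S'\<rparr>) (D\<lparr>Obj := T\<rparr>) F"
proof (intro bilinear_bifunctor.intro bilinear_bifunctor_axioms.intro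
    C.full_subcategory C'.full_subcategory D.full_subcategory assms(1-3), goal_cases)
  case (4 X1 X2 X3 Y1 Y2 Y3 f f' g g')
  then show ?case using assms(1,2) by (simp add: F_comp subset_iff)
qed (use assms in \<open>simp_all add: F_bilinear F_id subset_iff\<close>)

text \<open>
  The elementary tensor \<open>f \<otimes> g\<close> of \<open>f : a \<rightarrow> X\<^sup>k\<close> and \<open>g : b \<rightarrow> Y\<^sup>l\<close>, as a morphism into the
  component of degree \<open>k + l\<close>.  Statements about it take the degree as a separate variable \<open>n\<close> with
  \<open>k + l = n\<close>: the targets \<open>(k + 1) + l\<close>, \<open>k + (l + 1)\<close> and \<open>n + 1\<close> are equal but
  different as terms.
\<close>

definition summand_mor ::
  "('o3, 'm3, 'r) lincat \<Rightarrow> ('o1, 'm1, 'o2, 'm2, 'o3, 'm3) bifunctor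
    \<Rightarrow> ('o1, 'm1) diagram \<Rightarrow> ('o2, 'm2) diagram
    \<Rightarrow> 'o1 \<Rightarrow> 'o2 \<Rightarrow> int \<Rightarrow> int \<Rightarrow> 'm1 \<Rightarrow> 'm2 \<Rightarrow> 'm3"
  where
  "summand_mor D F X Y a b k l f g =
    Comp D (FObj F (a, b)) (FObj F (Term X k, Term Y l)) (coprod D (antidiag (k + l)) (F_family F X Y))
      (F_incl D F X Y k l) (FMor F (a, b) (Term X k, Term Y l) f g)"

locale twisted_tensor = bilinear_bifunctor R C C' D F
  for R :: "('r, 'x) ring_scheme" and C :: "('o1, 'm1, 'r) lincat"
    and C' :: "('o2, 'm2, 'r) lincat" and D :: "('o3, 'm3, 'r) lincat"
    and F :: "('o1, 'm1, 'o2, 'm2, 'o3, 'm3) bifunctor" +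
  fixes \<xi> :: 'r
  assumes scalars: "cring R"
    and coproducts: "has_countable_coproducts D"
    and \<xi>_unit: "\<xi> \<in> Units R"
begin

abbreviation T where "T X Y n \<equiv> coprod D (antidiag n) (F_family F X Y)"
abbreviation S where "S X Y i j \<equiv> FObj F (Term X i, Term Y j)"
abbreviation J where "J \<equiv> summand_mor D F"
abbreviation tensor where "tensor X Y \<equiv> F_xi_obj R \<xi> C C' D F (X, Y)"

lemma F_obj' [simp]: "X \<in> Obj C \<Longrightarrow> Y \<in> Obj C' \<Longrightarrow> FObj F (X, Y) \<in> Obj D"
  by (rule F_obj)

lemma \<xi>_pow_closed [simp]: "\<xi> [^]\<^bsub>R\<^esub> (i :: int) \<in> carrier R"
  using monoid.int_pow_unit_closed[OF _ \<xi>_unit] scalars by (simp add: cring_def ring_def)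

lemma tensor_Term [simp]: "Term (tensor X Y) n = T X Y n"
  by (simp add: F_xi_obj_def Let_def)

context
  fixes X Y
  assumes X [simp]: "inf_complex C X" and Y [simp]: "inf_complex C' Y"
begin

lemma family_obj [simp]: "F_family F X Y x \<in> Obj D"
  by (simp add: F_family_def split: prod.split)

lemma countable_antidiag: "countable (antidiag n)"
  by simp

lemma T_coproduct:
  "is_coproduct D (antidiag n) (F_family F X Y) (T X Y n) (incl D (antidiag n) (F_family F X Y))"
  by (rule is_coproduct_coprod[OF coproducts]) auto

lemma T_obj [simp]: "T X Y n \<in> Obj D"
  using T_coproduct by (simp add: is_coproduct_def)

lemma F_incl_closed [simp]:
  "k + l = n \<Longrightarrow> F_incl D F X Y k l \<in> carrier (Hom D (S X Y k l) (T X Y n))"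
  using T_coproduct[of n] by (auto simp: is_coproduct_def F_incl_def antidiag_def F_family_def)

lemma summand_mor_closed [simp]:
  "a \<in> Obj C \<Longrightarrow> b \<in> Obj C' \<Longrightarrow> f \<in> carrier (Hom C a (Term X k)) \<Longrightarrow>
    g \<in> carrier (Hom C' b (Term Y l)) \<Longrightarrow> k + l = n \<Longrightarrow>
    J X Y a b k l f g \<in> carrier (Hom D (FObj F (a, b)) (T X Y n))"
  by (auto simp: summand_mor_def)

lemma summand_mor_id:
  "J X Y (Term X i) (Term Y j) i j (Id C (Term X i)) (Id C' (Term Y j)) = F_incl D F X Y i j"
  by (simp add: summand_mor_def F_id D.id_right)

lemma summand_mor_bilinear:
  assumes a: "a \<in> Obj C" and b: "b \<in> Obj C'" and n: "k + l = n"
  shows "bilinear_map R (Hom C a (Term X k)) (Hom C' b (Term Y l)) (Hom D (FObj F (a, b)) (T X Y n))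
    (J X Y a b k l)"
proof -
  have "bilinear_map R (Hom C a (Term X k)) (Hom C' b (Term Y l))
      (Hom D (FObj F (a, b)) (S X Y k l)) (FMor F (a, b) (Term X k, Term Y l))"
    using a b by (simp add: F_bilinear)
  then show ?thesis using a b n
    by (auto simp: bilinear_map_def linear_map_def summand_mor_def D.comp_add_right D.comp_smult_right)
qed

lemma summand_mor_zero_left:
  assumes "a \<in> Obj C" "b \<in> Obj C'" "k + l = n" "g \<in> carrier (Hom C' b (Term Y l))"
  shows "J X Y a b k l \<zero>\<^bsub>Hom C a (Term X k)\<^esub> g = \<zero>\<^bsub>Hom D (FObj F (a, b)) (T X Y n)\<^esub>"
  by (rule linear_map_zero[OF C.hom_module D.hom_module, of _ _ _ _ "\<lambda>f. J X Y a b k l f g"])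
    (use summand_mor_bilinear[OF assms(1-3)] assms in \<open>auto simp: bilinear_map_def\<close>)

lemma summand_mor_zero_right:
  assumes "a \<in> Obj C" "b \<in> Obj C'" "k + l = n" "f \<in> carrier (Hom C a (Term X k))"
  shows "J X Y a b k l f \<zero>\<^bsub>Hom C' b (Term Y l)\<^esub> = \<zero>\<^bsub>Hom D (FObj F (a, b)) (T X Y n)\<^esub>"
  by (rule linear_map_zero[OF C'.hom_module D.hom_module, of _ _ _ _ "\<lambda>g. J X Y a b k l f g"])
    (use summand_mor_bilinear[OF assms(1-3)] assms in \<open>auto simp: bilinear_map_def\<close>)

lemma tensor_ext:
  assumes Z: "Z \<in> Obj D" and h: "h \<in> carrier (Hom D (T X Y n) Z)" "h' \<in> carrier (Hom D (T X Y n) Z)"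
    and eq: "\<And>i j. i + j = n \<Longrightarrow>
      Comp D (S X Y i j) (T X Y n) Z h (F_incl D F X Y i j) =
      Comp D (S X Y i j) (T X Y n) Z h' (F_incl D F X Y i j)"
  shows "h = h'"
  using eq by (intro D.coproduct_ext[OF T_coproduct family_obj Z h])
    (auto simp: antidiag_def F_incl_def F_family_def)

lemma copair_F_incl:
  assumes Z: "Z \<in> Obj D" and f: "\<And>i j. i + j = n \<Longrightarrow> f (i, j) \<in> carrier (Hom D (S X Y i j) Z)"
  shows "copair D (antidiag n) (F_family F X Y) Z f \<in> carrier (Hom D (T X Y n) Z)"
    and "i + j = n \<Longrightarrow> Comp D (S X Y i j) (T X Y n) Z
      (copair D (antidiag n) (F_family F X Y) Z f) (F_incl D F X Y i j) = f (i, j)"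
proof -
  have f': "x \<in> antidiag n \<Longrightarrow> f x \<in> carrier (Hom D (F_family F X Y x) Z)" for x
    using f by (auto simp: antidiag_def F_family_def)
  have A: "F_family F X Y x \<in> Obj D" for x by (rule family_obj)
  show "copair D (antidiag n) (F_family F X Y) Z f \<in> carrier (Hom D (T X Y n) Z)"
    by (rule copair_closed[OF coproducts countable_antidiag A Z f'])
  show "Comp D (S X Y i j) (T X Y n) Z (copair D (antidiag n) (F_family F X Y) Z f) (F_incl D F X Y i j) = f (i, j)"
    if ij: "i + j = n"
  proof -
    have "(i, j) \<in> antidiag n" using ij by (simp add: antidiag_def)
    from copair_incl[where A = "F_family F X Y" and f = f, OF coproducts countable_antidiag A Z f' this] show ?thesis
      using ij by (simp add: F_incl_def F_family_def)
  qed
qed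

lemma tensor_Diff:
  shows tensor_Diff_closed: "Diff (tensor X Y) n \<in> carrier (Hom D (T X Y n) (T X Y (n + 1)))"
    and tensor_Diff_incl: "i + j = n \<Longrightarrow>
      Comp D (S X Y i j) (T X Y n) (T X Y (n + 1)) (Diff (tensor X Y) n) (F_incl D F X Y i j) =
        J X Y (Term X i) (Term Y j) (i + 1) j (Diff X i) (Id C' (Term Y j))
        \<oplus>\<^bsub>Hom D (S X Y i j) (T X Y (n + 1))\<^esub> (\<xi> [^]\<^bsub>R\<^esub> i) \<odot>\<^bsub>Hom D (S X Y i j) (T X Y (n + 1))\<^esub>
          J X Y (Term X i) (Term Y j) i (j + 1) (Id C (Term X i)) (Diff Y j)"
proof -
  define f where "f = (\<lambda>(i, j). J X Y (Term X i) (Term Y j) (i + 1) j (Diff X i) (Id C' (Term Y j))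
        \<oplus>\<^bsub>Hom D (S X Y i j) (T X Y (n + 1))\<^esub> (\<xi> [^]\<^bsub>R\<^esub> i) \<odot>\<^bsub>Hom D (S X Y i j) (T X Y (n + 1))\<^esub>
          J X Y (Term X i) (Term Y j) i (j + 1) (Id C (Term X i)) (Diff Y j))"
  have f: "f (i, j) \<in> carrier (Hom D (S X Y i j) (T X Y (n + 1)))" if "i + j = n" for i j
    using that by (simp add: f_def C.id_closed C'.id_closed)
  have E: "Diff (tensor X Y) n = copair D (antidiag n) (F_family F X Y) (T X Y (n + 1)) f"
    unfolding F_xi_obj_def Let_def prod.case diagram.simps
  proof (rule copair_cong)
    fix x assume "x \<in> antidiag n"
    then obtain i j where x: "x = (i, j)" and n: "i + j = n" by (auto simp: antidiag_def)
    have "i + 1 + j = n + 1" "i + (j + 1) = n + 1" using n by simp_all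
    then show "(case x of (i, j) \<Rightarrow>
        Comp D (F_family F X Y (i, j)) (F_family F X Y (i + 1, j)) (T X Y (n + 1))
          (F_incl D F X Y (i + 1) j)
          (FMor F (Term X i, Term Y j) (Term X (i + 1), Term Y j) (Diff X i) (Id C' (Term Y j)))
        \<oplus>\<^bsub>Hom D (F_family F X Y (i, j)) (T X Y (n + 1))\<^esub>
        (\<xi> [^]\<^bsub>R\<^esub> i) \<odot>\<^bsub>Hom D (F_family F X Y (i, j)) (T X Y (n + 1))\<^esub>
          Comp D (F_family F X Y (i, j)) (F_family F X Y (i, j + 1)) (T X Y (n + 1))
            (F_incl D F X Y i (j + 1))
            (FMor F (Term X i, Term Y j) (Term X i, Term Y (j + 1)) (Id C (Term X i)) (Diff Y j))) = f x"
      by (simp only: x f_def summand_mor_def F_family_def prod.case)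
  qed
  show "Diff (tensor X Y) n \<in> carrier (Hom D (T X Y n) (T X Y (n + 1)))"
    unfolding E by (rule copair_F_incl(1)[OF T_obj f])
  show "Comp D (S X Y i j) (T X Y n) (T X Y (n + 1)) (Diff (tensor X Y) n) (F_incl D F X Y i j) =
        J X Y (Term X i) (Term Y j) (i + 1) j (Diff X i) (Id C' (Term Y j))
        \<oplus>\<^bsub>Hom D (S X Y i j) (T X Y (n + 1))\<^esub> (\<xi> [^]\<^bsub>R\<^esub> i) \<odot>\<^bsub>Hom D (S X Y i j) (T X Y (n + 1))\<^esub>
          J X Y (Term X i) (Term Y j) i (j + 1) (Id C (Term X i)) (Diff Y j)" if "i + j = n"
    using copair_F_incl(2)[where f = f, OF T_obj f that] unfolding E by (simp add: f_def)
qed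

lemma tensor_inf_complex: "inf_complex D (tensor X Y)"
  unfolding inf_complex_def tensor_Term using tensor_Diff_closed by simp

text \<open>
  The twisted Leibniz rule.  By the functoriality of \<open>F\<close>, the defining formula on the inclusions
  extends to all elementary tensors.
\<close>

lemma tensor_Diff_summand:
  assumes a: "a \<in> Obj C" and b: "b \<in> Obj C'" and f: "f \<in> carrier (Hom C a (Term X k))"
    and g: "g \<in> carrier (Hom C' b (Term Y l))" and n: "k + l = n"
  shows "Comp D (FObj F (a, b)) (T X Y n) (T X Y (n + 1)) (Diff (tensor X Y) n) (J X Y a b k l f g) =
    J X Y a b (k + 1) l (Comp C a (Term X k) (Term X (k + 1)) (Diff X k) f) g
    \<oplus>\<^bsub>Hom D (FObj F (a, b)) (T X Y (n + 1))\<^esub> (\<xi> [^]\<^bsub>R\<^esub> k) \<odot>\<^bsub>Hom D (FObj F (a, b)) (T X Y (n + 1))\<^esub>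
      J X Y a b k (l + 1) f (Comp C' b (Term Y l) (Term Y (l + 1)) (Diff Y l) g)"
proof -
  let ?P = "FObj F (a, b)" and ?T = "T X Y n" and ?T' = "T X Y (n + 1)"
  let ?Fd = "FMor F (Term X k, Term Y l) (Term X (k + 1), Term Y l) (Diff X k) (Id C' (Term Y l))"
    and ?Fd' = "FMor F (Term X k, Term Y l) (Term X k, Term Y (l + 1)) (Id C (Term X k)) (Diff Y l)"
    and ?Ff = "FMor F (a, b) (Term X k, Term Y l) f g"
  note [simp] = a b f g tensor_Diff_closed C.id_closed C'.id_closed
  have n1: "k + 1 + l = n + 1" "k + (l + 1) = n + 1" using n by simp_all
  have i: "F_incl D F X Y k l \<in> carrier (Hom D (S X Y k l) ?T)"
    "F_incl D F X Y (k + 1) l \<in> carrier (Hom D (S X Y (k + 1) l) ?T')"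
    "F_incl D F X Y k (l + 1) \<in> carrier (Hom D (S X Y k (l + 1)) ?T')"
    by (rule F_incl_closed, use n in simp)+
  have 1: "Comp D ?P (S X Y k l) ?T' (J X Y (Term X k) (Term Y l) (k + 1) l (Diff X k) (Id C' (Term Y l))) ?Ff
      = J X Y a b (k + 1) l (Comp C a (Term X k) (Term X (k + 1)) (Diff X k) f) g"
  proof -
    have "Comp D ?P (S X Y k l) (S X Y (k + 1) l) ?Fd ?Ff =
        FMor F (a, b) (Term X (k + 1), Term Y l) (Comp C a (Term X k) (Term X (k + 1)) (Diff X k) f) g"
      by (subst F_comp[symmetric]) (simp_all add: C'.id_left)
    then show ?thesis using i unfolding summand_mor_def n1
      by (subst D.comp_assoc[symmetric]) simp_all
  qed
  have 2: "Comp D ?P (S X Y k l) ?T' (J X Y (Term X k) (Term Y l) k (l + 1) (Id C (Term X k)) (Diff Y l)) ?Ff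
      = J X Y a b k (l + 1) f (Comp C' b (Term Y l) (Term Y (l + 1)) (Diff Y l) g)"
  proof -
    have "Comp D ?P (S X Y k l) (S X Y k (l + 1)) ?Fd' ?Ff =
        FMor F (a, b) (Term X k, Term Y (l + 1)) f (Comp C' b (Term Y l) (Term Y (l + 1)) (Diff Y l) g)"
      by (subst F_comp[symmetric]) (simp_all add: C.id_left)
    then show ?thesis using i unfolding summand_mor_def n1
      by (subst D.comp_assoc[symmetric]) simp_all
  qed
  have "Comp D ?P ?T ?T' (Diff (tensor X Y) n) (J X Y a b k l f g)
      = Comp D ?P (S X Y k l) ?T' (Comp D (S X Y k l) ?T ?T' (Diff (tensor X Y) n) (F_incl D F X Y k l)) ?Ff"
    using i unfolding summand_mor_def n by (simp add: D.comp_assoc)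
  also have "\<dots> = Comp D ?P (S X Y k l) ?T' (J X Y (Term X k) (Term Y l) (k + 1) l (Diff X k) (Id C' (Term Y l))) ?Ff
    \<oplus>\<^bsub>Hom D ?P ?T'\<^esub> (\<xi> [^]\<^bsub>R\<^esub> k) \<odot>\<^bsub>Hom D ?P ?T'\<^esub>
      Comp D ?P (S X Y k l) ?T' (J X Y (Term X k) (Term Y l) k (l + 1) (Id C (Term X k)) (Diff Y l)) ?Ff"
    unfolding tensor_Diff_incl[OF n] using n by (simp add: D.comp_add_left D.comp_smult_left)
  finally show ?thesis unfolding 1 2 .
qed

section \<open>Powers of the differential of a tensor product\<close>

text \<open>
  The twisted binomial theorem for \<open>d\<^sup>k\<close> on the summand \<open>(i, j)\<close>.  Applying \<open>d\<close> to
  \<open>d\<^sup>m \<otimes> d\<^sup>k\<^sup>-\<^sup>m\<close>, whose first factor has degree \<open>i + m\<close>, contributes \<open>\<xi>\<^sup>i\<^sup>+\<^sup>m = \<xi>\<^sup>i \<xi>\<^sup>m\<close>; the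
  constant factors \<open>\<xi>\<^sup>i\<close> accumulate to \<open>(\<xi>\<^sup>i)\<^sup>k\<^sup>-\<^sup>m\<close> and the factors \<open>\<xi>\<^sup>m\<close> build up the
  Gaussian coefficient.
\<close>

lemma tensor_iterated_diff:
  assumes n: "i + j = n"
  shows "Comp D (S X Y i j) (T X Y n) (T X Y (n + int k)) (iterated_diff D (tensor X Y) n k) (F_incl D F X Y i j)
    = finsum (Hom D (S X Y i j) (T X Y (n + int k)))
        (\<lambda>m. ((\<xi> [^]\<^bsub>R\<^esub> i) [^]\<^bsub>R\<^esub> (k - m) \<otimes>\<^bsub>R\<^esub> gauss_binomial R \<xi> k m) \<odot>\<^bsub>Hom D (S X Y i j) (T X Y (n + int k))\<^esub>
          J X Y (Term X i) (Term Y j) (i + int m) (j + int (k - m))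
            (iterated_diff C X i m) (iterated_diff C' Y j (k - m))) {..k}"
proof (induction k)
  case 0
  interpret M: module R "Hom D (S X Y i j) (T X Y n)" by (rule D.hom_module) simp_all
  show ?case using n by (simp add: D.id_left summand_mor_id)
next
  case (Suc k)
  let ?A = "S X Y i j" and ?T = "T X Y n" and ?T1 = "T X Y (n + int k)" and ?T2 = "T X Y (n + int k + 1)"
  let ?H1 = "Hom D ?A ?T1" and ?H2 = "Hom D ?A ?T2"
  let ?a = "\<xi> [^]\<^bsub>R\<^esub> i" and ?G = "gauss_binomial R \<xi>"
  let ?J = "\<lambda>m l. J X Y (Term X i) (Term Y j) (i + int m) (j + int l) (iterated_diff C X i m) (iterated_diff C' Y j l)"
  let ?it = "iterated_diff D (tensor X Y) n"
  let ?c = "\<lambda>m. ?a [^]\<^bsub>R\<^esub> (k - m) \<otimes>\<^bsub>R\<^esub> ?G k m"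
  interpret M1: module R "?H1" by (rule D.hom_module) simp_all
  interpret M2: module R "?H2" by (rule D.hom_module) simp_all
  have xi: "\<xi> \<in> carrier R" using \<xi>_unit by (rule M1.R.Units_closed)
  have nS: "n + int (Suc k) = n + int k + 1" by simp
  have it: "?it k \<in> carrier (Hom D ?T ?T1)"
    using D.iterated_diff_closed[OF tensor_inf_complex, of n k] by simp
  have Jcl: "?J m l \<in> carrier (Hom D ?A (T X Y n'))" if "n + int m + int l = n'" for m l n'
    using that n C.iterated_diff_closed[OF X, of i m] C'.iterated_diff_closed[OF Y, of j l]
    by (intro summand_mor_closed) simp_all
  have J1: "?J m (k - m) \<in> carrier ?H1" if "m \<le> k" for m
    using that by (intro Jcl) (simp add: of_nat_diff)
  have c: "?c m \<in> carrier R" for m using xi by simp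
  have DJ: "Comp D ?A ?T1 ?T2 (Diff (tensor X Y) (n + int k)) (?J m (k - m)) =
      ?J (Suc m) (Suc k - Suc m) \<oplus>\<^bsub>?H2\<^esub> (?a \<otimes>\<^bsub>R\<^esub> \<xi> [^]\<^bsub>R\<^esub> m) \<odot>\<^bsub>?H2\<^esub> ?J m (Suc k - m)"
    if m: "m \<le> k" for m
  proof -
    have e: "Suc k - m = Suc (k - m)" using m by simp
    have e2: "i + int m + 1 = i + int (Suc m)" "j + int (k - m) + 1 = j + int (Suc (k - m))" by simp_all
    have pw: "\<xi> [^]\<^bsub>R\<^esub> (i + int m) = ?a \<otimes>\<^bsub>R\<^esub> \<xi> [^]\<^bsub>R\<^esub> m"
      by (rule M1.R.int_pow_add_nat_unit[OF \<xi>_unit])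
    have itX: "Comp C (Term X i) (Term X (i + int m)) (Term X (i + int (Suc m))) (Diff X (i + int m)) (iterated_diff C X i m)
        = iterated_diff C X i (Suc m)"
      by (simp add: add_ac)
    have itY: "Comp C' (Term Y j) (Term Y (j + int (k - m))) (Term Y (j + int (Suc (k - m)))) (Diff Y (j + int (k - m))) (iterated_diff C' Y j (k - m))
        = iterated_diff C' Y j (Suc (k - m))"
      by (simp add: add_ac)
    have "(i + int m) + (j + int (k - m)) = n + int k" using n m by (simp add: of_nat_diff)
    from tensor_Diff_summand[OF _ _ C.iterated_diff_closed[OF X, of i m] C'.iterated_diff_closed[OF Y, of j "k - m"] this]
    show ?thesis unfolding e2 pw itX itY e diff_Suc_Suc by simp
  qed
  have "Comp D ?A ?T ?T2 (?it (Suc k)) (F_incl D F X Y i j)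
     = Comp D ?A ?T1 ?T2 (Diff (tensor X Y) (n + int k)) (Comp D ?A ?T ?T1 (?it k) (F_incl D F X Y i j))"
    using it n tensor_Diff_closed[of "n + int k"] by (simp add: D.comp_assoc)
  also have "\<dots> = Comp D ?A ?T1 ?T2 (Diff (tensor X Y) (n + int k)) (finsum ?H1 (\<lambda>m. ?c m \<odot>\<^bsub>?H1\<^esub> ?J m (k - m)) {..k})"
    by (simp only: Suc.IH)
  also have "\<dots> = finsum ?H2 (\<lambda>m. Comp D ?A ?T1 ?T2 (Diff (tensor X Y) (n + int k)) (?c m \<odot>\<^bsub>?H1\<^esub> ?J m (k - m))) {..k}"
  proof (rule D.comp_finsum_right)
    show "?c m \<odot>\<^bsub>?H1\<^esub> ?J m (k - m) \<in> carrier ?H1" if "m \<in> {..k}" for m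
      using that by (intro M1.smult_closed c J1) simp
  qed (simp_all add: tensor_Diff_closed)
  also have "\<dots> = finsum ?H2 (\<lambda>m. ?c m \<odot>\<^bsub>?H2\<^esub>
      (?J (Suc m) (Suc k - Suc m) \<oplus>\<^bsub>?H2\<^esub> (?a \<otimes>\<^bsub>R\<^esub> \<xi> [^]\<^bsub>R\<^esub> m) \<odot>\<^bsub>?H2\<^esub> ?J m (Suc k - m))) {..k}"
  proof (rule M2.M.finsum_cong'[OF refl])
    show "(\<lambda>m. ?c m \<odot>\<^bsub>?H2\<^esub>
      (?J (Suc m) (Suc k - Suc m) \<oplus>\<^bsub>?H2\<^esub> (?a \<otimes>\<^bsub>R\<^esub> \<xi> [^]\<^bsub>R\<^esub> m) \<odot>\<^bsub>?H2\<^esub> ?J m (Suc k - m))) \<in> {..k} \<rightarrow> carrier ?H2"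
      using xi by (intro Pi_I M2.smult_closed M2.M.a_closed c Jcl) (auto simp: of_nat_diff)
    fix m assume "m \<in> {..k}"
    then have m: "m \<le> k" by simp
    have "Comp D ?A ?T1 ?T2 (Diff (tensor X Y) (n + int k)) (?c m \<odot>\<^bsub>?H1\<^esub> ?J m (k - m))
      = ?c m \<odot>\<^bsub>?H2\<^esub> Comp D ?A ?T1 ?T2 (Diff (tensor X Y) (n + int k)) (?J m (k - m))"
      by (rule D.comp_smult_right) (simp_all only: tensor_Diff_closed c J1[OF m], simp_all)
    then show "Comp D ?A ?T1 ?T2 (Diff (tensor X Y) (n + int k)) (?c m \<odot>\<^bsub>?H1\<^esub> ?J m (k - m))
      = ?c m \<odot>\<^bsub>?H2\<^esub> (?J (Suc m) (Suc k - Suc m) \<oplus>\<^bsub>?H2\<^esub> (?a \<otimes>\<^bsub>R\<^esub> \<xi> [^]\<^bsub>R\<^esub> m) \<odot>\<^bsub>?H2\<^esub> ?J m (Suc k - m))"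
      by (simp only: DJ[OF m])
  qed
  also have "\<dots> = finsum ?H2 (\<lambda>m. (?a [^]\<^bsub>R\<^esub> (Suc k - m) \<otimes>\<^bsub>R\<^esub> ?G (Suc k) m) \<odot>\<^bsub>?H2\<^esub> ?J m (Suc k - m)) {..Suc k}"
  proof (rule M2.twisted_pascal_sum)
    show "?J m (Suc k - m) \<in> carrier ?H2" if "m \<le> Suc k" for m
      using that by (intro Jcl) (simp add: of_nat_diff)
  qed (simp_all add: xi)
  finally show ?case unfolding nS .
qed

text \<open>
  In the expansion of \<open>d\<^sup>N\<close> the two outer terms contain \<open>d\<^sup>N\<close> of a factor, and the inner
  ones are killed by their coefficients.
\<close>

lemma tensor_N_complex:
  assumes XN: "\<And>i. iterated_diff C X i N = \<zero>\<^bsub>Hom C (Term X i) (Term X (i + int N))\<^esub>"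
    and YN: "\<And>j. iterated_diff C' Y j N = \<zero>\<^bsub>Hom C' (Term Y j) (Term Y (j + int N))\<^esub>"
    and van: "\<And>A B x m. A \<in> Obj D \<Longrightarrow> B \<in> Obj D \<Longrightarrow> x \<in> carrier (Hom D A B) \<Longrightarrow> 0 < m \<Longrightarrow> m < N \<Longrightarrow>
      gauss_binomial R \<xi> N m \<odot>\<^bsub>Hom D A B\<^esub> x = \<zero>\<^bsub>Hom D A B\<^esub>"
  shows "iterated_diff D (tensor X Y) n N = \<zero>\<^bsub>Hom D (T X Y n) (T X Y (n + int N))\<^esub>"
proof (rule tensor_ext)
  show "iterated_diff D (tensor X Y) n N \<in> carrier (Hom D (T X Y n) (T X Y (n + int N)))"
    using D.iterated_diff_closed[OF tensor_inf_complex, of n N] by simp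
  fix i j assume n: "i + j = n"
  let ?A = "S X Y i j" and ?T = "T X Y (n + int N)"
  let ?J = "\<lambda>m l. J X Y (Term X i) (Term Y j) (i + int m) (j + int l) (iterated_diff C X i m) (iterated_diff C' Y j l)"
  interpret M: module R "Hom D ?A ?T" by (rule D.hom_module) simp_all
  have xi: "\<xi> \<in> carrier R" using \<xi>_unit by (rule M.R.Units_closed)
  have term0: "((\<xi> [^]\<^bsub>R\<^esub> i) [^]\<^bsub>R\<^esub> (N - m) \<otimes>\<^bsub>R\<^esub> gauss_binomial R \<xi> N m) \<odot>\<^bsub>Hom D ?A ?T\<^esub> ?J m (N - m) = \<zero>\<^bsub>Hom D ?A ?T\<^esub>"
    if m: "m \<le> N" for m
  proof -
    have J: "?J m (N - m) \<in> carrier (Hom D ?A ?T)"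
      using m n C.iterated_diff_closed[OF X, of i m] C'.iterated_diff_closed[OF Y, of j "N - m"]
      by (intro summand_mor_closed) (simp_all add: of_nat_diff)
    consider "m = N" | "m = 0" | "0 < m" "m < N" using m by linarith
    then show ?thesis
    proof cases
      case 1
      have "?J m (N - m) = \<zero>\<^bsub>Hom D ?A ?T\<^esub>"
        unfolding \<open>m = N\<close> XN diff_self_eq_0
        by (rule summand_mor_zero_left) (use n in \<open>simp_all add: C'.id_closed\<close>)
      then show ?thesis using xi by simp
    next
      case 2
      have "?J m (N - m) = \<zero>\<^bsub>Hom D ?A ?T\<^esub>"
        unfolding 2 diff_zero YN
        by (rule summand_mor_zero_right) (use n in \<open>simp_all add: C.id_closed\<close>)
      then show ?thesis using xi by simp
    next
      case 3
      then have "gauss_binomial R \<xi> N m \<odot>\<^bsub>Hom D ?A ?T\<^esub> ?J m (N - m) = \<zero>\<^bsub>Hom D ?A ?T\<^esub>"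
        using J by (intro van) simp_all
      then show ?thesis using J xi by (simp add: M.smult_assoc1)
    qed
  qed
  have "Comp D ?A (T X Y n) ?T (iterated_diff D (tensor X Y) n N) (F_incl D F X Y i j) = \<zero>\<^bsub>Hom D ?A ?T\<^esub>"
    unfolding tensor_iterated_diff[OF n]
    by (rule M.M.add.finprod_one_eqI) (simp only: term0 atMost_iff)
  then show "Comp D ?A (T X Y n) ?T (iterated_diff D (tensor X Y) n N) (F_incl D F X Y i j)
    = Comp D ?A (T X Y n) ?T \<zero>\<^bsub>Hom D (T X Y n) ?T\<^esub> (F_incl D F X Y i j)"
    using n by simp
qed simp_all

end

section \<open>Functoriality of the tensor product\<close>

context
  fixes X Y X' Y'
  assumes X [simp]: "inf_complex C X" and Y [simp]: "inf_complex C' Y"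
    and X' [simp]: "inf_complex C X'" and Y' [simp]: "inf_complex C' Y'"
begin

lemma
  assumes f [simp]: "inf_complex_mor C X X' f" and g [simp]: "inf_complex_mor C' Y Y' g"
  shows F_xi_mor_closed: "F_xi_mor D F (X, Y) (X', Y') f g n \<in> carrier (Hom D (T X Y n) (T X' Y' n))"
    and F_xi_mor_incl: "i + j = n \<Longrightarrow>
      Comp D (S X Y i j) (T X Y n) (T X' Y' n) (F_xi_mor D F (X, Y) (X', Y') f g n) (F_incl D F X Y i j) =
        J X' Y' (Term X i) (Term Y j) i j (f i) (g j)"
proof -
  define h where "h = (\<lambda>(i, j). J X' Y' (Term X i) (Term Y j) i j (f i) (g j))"
  have h: "h (i, j) \<in> carrier (Hom D (S X Y i j) (T X' Y' n))" if "i + j = n" for i j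
    using that by (simp add: h_def)
  have E: "F_xi_mor D F (X, Y) (X', Y') f g n = copair D (antidiag n) (F_family F X Y) (T X' Y' n) h"
    unfolding F_xi_mor_def Let_def prod.case
    by (rule copair_cong) (auto simp: antidiag_def h_def summand_mor_def F_family_def)
  show "F_xi_mor D F (X, Y) (X', Y') f g n \<in> carrier (Hom D (T X Y n) (T X' Y' n))"
    unfolding E by (rule copair_F_incl(1)[OF X Y T_obj[OF X' Y'] h])
  show "Comp D (S X Y i j) (T X Y n) (T X' Y' n) (F_xi_mor D F (X, Y) (X', Y') f g n) (F_incl D F X Y i j) =
        J X' Y' (Term X i) (Term Y j) i j (f i) (g j)" if "i + j = n"
    using copair_F_incl(2)[where f = h, OF X Y T_obj[OF X' Y'] h that] unfolding E by (simp add: h_def)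
qed

lemma F_xi_mor_summand:
  assumes f [simp]: "inf_complex_mor C X X' f" and g [simp]: "inf_complex_mor C' Y Y' g"
    and [simp]: "a \<in> Obj C" "b \<in> Obj C'" "u \<in> carrier (Hom C a (Term X k))" "v \<in> carrier (Hom C' b (Term Y l))"
    and n: "k + l = n"
  shows "Comp D (FObj F (a, b)) (T X Y n) (T X' Y' n) (F_xi_mor D F (X, Y) (X', Y') f g n) (J X Y a b k l u v) =
    J X' Y' a b k l (Comp C a (Term X k) (Term X' k) (f k) u) (Comp C' b (Term Y l) (Term Y' l) (g l) v)"
proof -
  have i [simp]: "F_incl D F X Y k l \<in> carrier (Hom D (S X Y k l) (T X Y n))"
    "F_incl D F X' Y' k l \<in> carrier (Hom D (S X' Y' k l) (T X' Y' n))"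
    using n by (simp_all add: F_incl_closed)
  have "Comp D (FObj F (a, b)) (T X Y n) (T X' Y' n) (F_xi_mor D F (X, Y) (X', Y') f g n) (J X Y a b k l u v)
    = Comp D (FObj F (a, b)) (S X Y k l) (T X' Y' n)
        (Comp D (S X Y k l) (T X Y n) (T X' Y' n) (F_xi_mor D F (X, Y) (X', Y') f g n) (F_incl D F X Y k l))
        (FMor F (a, b) (Term X k, Term Y l) u v)"
    unfolding summand_mor_def n by (simp add: D.comp_assoc F_xi_mor_closed T_obj)
  also have "\<dots> = J X' Y' a b k l (Comp C a (Term X k) (Term X' k) (f k) u) (Comp C' b (Term Y l) (Term Y' l) (g l) v)"
    unfolding F_xi_mor_incl[OF f g n] summand_mor_def n
    by (subst F_comp, simp_all) (simp add: D.comp_assoc T_obj)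
  finally show ?thesis .
qed

text \<open>
  Both composites send \<open>id \<otimes> id\<close> on the summand \<open>(i, j)\<close> to \<open>d f \<otimes> g + \<xi>\<^sup>i f \<otimes> d g\<close>, because \<open>f\<close> and \<open>g\<close>
  commute with the differentials and preserve the degree \<open>i\<close> on which the twist depends.
\<close>

lemma F_xi_mor_chain_map:
  assumes f: "inf_complex_mor C X X' f" and g: "inf_complex_mor C' Y Y' g"
  shows "inf_complex_mor D (tensor X Y) (tensor X' Y') (F_xi_mor D F (X, Y) (X', Y') f g)"
  unfolding inf_complex_mor_def tensor_Term
proof (intro allI conjI)
  fix n
  let ?h = "F_xi_mor D F (X, Y) (X', Y') f g"
  let ?T = "T X Y n" and ?T1 = "T X Y (n + 1)" and ?T' = "T X' Y' n" and ?T1' = "T X' Y' (n + 1)"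
  note [simp] = f g F_xi_mor_closed T_obj tensor_Diff_closed F_incl_closed summand_mor_closed
    C.id_closed C'.id_closed
  show "?h n \<in> carrier (Hom D ?T ?T')" by simp
  show "Comp D ?T ?T1 ?T1' (?h (n + 1)) (Diff (tensor X Y) n) =
      Comp D ?T ?T' ?T1' (Diff (tensor X' Y') n) (?h n)"
  proof (rule tensor_ext[OF X Y])
    fix i j assume n: "i + j = n"
    have n1: "i + 1 + j = n + 1" "i + (j + 1) = n + 1" using n by simp_all
    let ?A = "S X Y i j" and ?\<iota> = "F_incl D F X Y i j"
    have \<iota>: "?\<iota> \<in> carrier (Hom D ?A ?T)" using n by simp
    have fd: "Comp C (Term X i) (Term X (i + 1)) (Term X' (i + 1)) (f (i + 1)) (Diff X i) =
        Comp C (Term X i) (Term X' i) (Term X' (i + 1)) (Diff X' i) (f i)"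
      using f by (simp add: inf_complex_mor_def)
    have gd: "Comp C' (Term Y j) (Term Y (j + 1)) (Term Y' (j + 1)) (g (j + 1)) (Diff Y j) =
        Comp C' (Term Y j) (Term Y' j) (Term Y' (j + 1)) (Diff Y' j) (g j)"
      using g by (simp add: inf_complex_mor_def)
    have J1: "J X Y (Term X i) (Term Y j) (i + 1) j (Diff X i) (Id C' (Term Y j)) \<in> carrier (Hom D ?A ?T1)"
      using n1 by (intro summand_mor_closed) simp_all
    have J2: "J X Y (Term X i) (Term Y j) i (j + 1) (Id C (Term X i)) (Diff Y j) \<in> carrier (Hom D ?A ?T1)"
      using n1 by (intro summand_mor_closed) simp_all
    have "Comp D ?A ?T ?T1' (Comp D ?T ?T1 ?T1' (?h (n + 1)) (Diff (tensor X Y) n)) ?\<iota>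
        = Comp D ?A ?T1 ?T1' (?h (n + 1)) (Comp D ?A ?T ?T1 (Diff (tensor X Y) n) ?\<iota>)"
      using \<iota> by (simp add: D.comp_assoc)
    also have "\<dots> = J X' Y' (Term X i) (Term Y j) (i + 1) j
          (Comp C (Term X i) (Term X' i) (Term X' (i + 1)) (Diff X' i) (f i)) (g j)
        \<oplus>\<^bsub>Hom D ?A ?T1'\<^esub> (\<xi> [^]\<^bsub>R\<^esub> i) \<odot>\<^bsub>Hom D ?A ?T1'\<^esub> J X' Y' (Term X i) (Term Y j) i (j + 1) (f i)
          (Comp C' (Term Y j) (Term Y' j) (Term Y' (j + 1)) (Diff Y' j) (g j))"
      using J1 J2 n1 unfolding tensor_Diff_incl[OF X Y n]
      by (simp add: D.comp_add_right D.comp_smult_right F_xi_mor_summand[OF f g _ _ _ _ n1(1)]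
          F_xi_mor_summand[OF f g _ _ _ _ n1(2)] C.id_right C'.id_right fd gd)
    also have "\<dots> = Comp D ?A ?T' ?T1' (Diff (tensor X' Y') n) (Comp D ?A ?T ?T' (?h n) ?\<iota>)"
      using n by (simp add: F_xi_mor_incl tensor_Diff_summand)
    also have "\<dots> = Comp D ?A ?T ?T1' (Comp D ?T ?T' ?T1' (Diff (tensor X' Y') n) (?h n)) ?\<iota>"
      using \<iota> by (simp add: D.comp_assoc)
    finally show "Comp D ?A ?T ?T1' (Comp D ?T ?T1 ?T1' (?h (n + 1)) (Diff (tensor X Y) n)) ?\<iota>
        = Comp D ?A ?T ?T1' (Comp D ?T ?T' ?T1' (Diff (tensor X' Y') n) (?h n)) ?\<iota>" .
  qed simp_all
qed

text \<open>
  On each summand the morphism is the tensor \<open>f\<^sup>i \<otimes> g\<^sup>j\<close>, so bilinearity is inherited from that of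
  \<open>F\<close>.
\<close>

lemma F_xi_mor_bilinear:
  "bilinear_map R (Hom (C_inf C) X X') (Hom (C_inf C') Y Y') (Hom (C_inf D) (tensor X Y) (tensor X' Y'))
    (F_xi_mor D F (X, Y) (X', Y'))"
proof -
  note cl = F_xi_mor_closed T_obj F_incl_closed summand_mor_closed
  have lin: "bilinear_map R (Hom C (Term X i) (Term X' i)) (Hom C' (Term Y j) (Term Y' j))
      (Hom D (S X Y i j) (T X' Y' n)) (J X' Y' (Term X i) (Term Y j) i j)" if "i + j = n" for i j n
    using that by (intro summand_mor_bilinear) simp_all
  have ext: "h = h'" if "h \<in> carrier (Hom D (T X Y n) (T X' Y' n))" "h' \<in> carrier (Hom D (T X Y n) (T X' Y' n))"
    "\<And>i j. i + j = n \<Longrightarrow> Comp D (S X Y i j) (T X Y n) (T X' Y' n) h (F_incl D F X Y i j)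
      = Comp D (S X Y i j) (T X Y n) (T X' Y' n) h' (F_incl D F X Y i j)" for h h' n
    by (rule tensor_ext[OF X Y T_obj[OF X' Y'] that])
  have "F_xi_mor D F (X, Y) (X', Y') f (\<lambda>n. g n \<oplus>\<^bsub>Hom C' (Term Y n) (Term Y' n)\<^esub> g' n) n =
      F_xi_mor D F (X, Y) (X', Y') f g n \<oplus>\<^bsub>Hom D (T X Y n) (T X' Y' n)\<^esub> F_xi_mor D F (X, Y) (X', Y') f g' n"
    if "inf_complex_mor C X X' f" "inf_complex_mor C' Y Y' g" "inf_complex_mor C' Y Y' g'" for f g g' n
  proof (rule ext)
    fix i j assume n: "i + j = n"
    show "Comp D (S X Y i j) (T X Y n) (T X' Y' n) (F_xi_mor D F (X, Y) (X', Y') f (\<lambda>n. g n \<oplus>\<^bsub>Hom C' (Term Y n) (Term Y' n)\<^esub> g' n) n) (F_incl D F X Y i j)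
        = Comp D (S X Y i j) (T X Y n) (T X' Y' n) (F_xi_mor D F (X, Y) (X', Y') f g n \<oplus>\<^bsub>Hom D (T X Y n) (T X' Y' n)\<^esub> F_xi_mor D F (X, Y) (X', Y') f g' n) (F_incl D F X Y i j)"
      using lin[OF n] that n
      by (simp add: cl F_xi_mor_incl C'.chain_map_add D.comp_add_left bilinear_map_def linear_map_def)
  qed (use that in \<open>simp_all add: cl C'.chain_map_add\<close>)
  moreover have "F_xi_mor D F (X, Y) (X', Y') (\<lambda>n. f n \<oplus>\<^bsub>Hom C (Term X n) (Term X' n)\<^esub> f' n) g n =
      F_xi_mor D F (X, Y) (X', Y') f g n \<oplus>\<^bsub>Hom D (T X Y n) (T X' Y' n)\<^esub> F_xi_mor D F (X, Y) (X', Y') f' g n"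
    if "inf_complex_mor C X X' f" "inf_complex_mor C X X' f'" "inf_complex_mor C' Y Y' g" for f f' g n
  proof (rule ext)
    fix i j assume n: "i + j = n"
    show "Comp D (S X Y i j) (T X Y n) (T X' Y' n) (F_xi_mor D F (X, Y) (X', Y') (\<lambda>n. f n \<oplus>\<^bsub>Hom C (Term X n) (Term X' n)\<^esub> f' n) g n) (F_incl D F X Y i j)
        = Comp D (S X Y i j) (T X Y n) (T X' Y' n) (F_xi_mor D F (X, Y) (X', Y') f g n \<oplus>\<^bsub>Hom D (T X Y n) (T X' Y' n)\<^esub> F_xi_mor D F (X, Y) (X', Y') f' g n) (F_incl D F X Y i j)"
      using lin[OF n] that n
      by (simp add: cl F_xi_mor_incl C.chain_map_add D.comp_add_left bilinear_map_def linear_map_def)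
  qed (use that in \<open>simp_all add: cl C.chain_map_add\<close>)
  moreover have "F_xi_mor D F (X, Y) (X', Y') f (\<lambda>n. r \<odot>\<^bsub>Hom C' (Term Y n) (Term Y' n)\<^esub> g n) n =
      r \<odot>\<^bsub>Hom D (T X Y n) (T X' Y' n)\<^esub> F_xi_mor D F (X, Y) (X', Y') f g n"
    if "inf_complex_mor C X X' f" "inf_complex_mor C' Y Y' g" "r \<in> carrier R" for f g r n
  proof (rule ext)
    fix i j assume n: "i + j = n"
    show "Comp D (S X Y i j) (T X Y n) (T X' Y' n) (F_xi_mor D F (X, Y) (X', Y') f (\<lambda>n. r \<odot>\<^bsub>Hom C' (Term Y n) (Term Y' n)\<^esub> g n) n) (F_incl D F X Y i j)
        = Comp D (S X Y i j) (T X Y n) (T X' Y' n) (r \<odot>\<^bsub>Hom D (T X Y n) (T X' Y' n)\<^esub> F_xi_mor D F (X, Y) (X', Y') f g n) (F_incl D F X Y i j)"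
      using lin[OF n] that n
      by (simp add: cl F_xi_mor_incl C'.chain_map_smult D.comp_smult_left bilinear_map_def linear_map_def)
  qed (use that in \<open>simp_all add: cl C'.chain_map_smult\<close>)
  moreover have "F_xi_mor D F (X, Y) (X', Y') (\<lambda>n. r \<odot>\<^bsub>Hom C (Term X n) (Term X' n)\<^esub> f n) g n =
      r \<odot>\<^bsub>Hom D (T X Y n) (T X' Y' n)\<^esub> F_xi_mor D F (X, Y) (X', Y') f g n"
    if "inf_complex_mor C X X' f" "inf_complex_mor C' Y Y' g" "r \<in> carrier R" for f g r n
  proof (rule ext)
    fix i j assume n: "i + j = n"
    show "Comp D (S X Y i j) (T X Y n) (T X' Y' n) (F_xi_mor D F (X, Y) (X', Y') (\<lambda>n. r \<odot>\<^bsub>Hom C (Term X n) (Term X' n)\<^esub> f n) g n) (F_incl D F X Y i j)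
        = Comp D (S X Y i j) (T X Y n) (T X' Y' n) (r \<odot>\<^bsub>Hom D (T X Y n) (T X' Y' n)\<^esub> F_xi_mor D F (X, Y) (X', Y') f g n) (F_incl D F X Y i j)"
      using lin[OF n] that n
      by (simp add: cl F_xi_mor_incl C.chain_map_smult D.comp_smult_left bilinear_map_def linear_map_def)
  qed (use that in \<open>simp_all add: cl C.chain_map_smult\<close>)
  ultimately show ?thesis
    by (auto simp: bilinear_map_def linear_map_def F_xi_mor_chain_map fun_eq_iff)
qed

end

lemma F_xi_bifunctor:
  "bilinear_bifunctor R (C_inf C) (C_inf C') (C_inf D) (F_xi R \<xi> C C' D F)"
proof (intro bilinear_bifunctor.intro bilinear_bifunctor_axioms.intro
    C.C_inf_linear_category C'.C_inf_linear_category D.C_inf_linear_category, goal_cases)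
  case (1 X Y)
  then show ?case by (simp add: F_xi_def tensor_inf_complex)
next
  case (2 X X' Y Y')
  then show ?case by (simp add: F_xi_def F_xi_mor_bilinear)
next
  case (3 X Y)
  then have X: "inf_complex C X" and Y: "inf_complex C' Y" by simp_all
  have "F_xi_mor D F (X, Y) (X, Y) (\<lambda>n. Id C (Term X n)) (\<lambda>n. Id C' (Term Y n)) n = Id D (T X Y n)" for n
    by (rule tensor_ext[OF X Y, where n = n and Z = "T X Y n"])
      (use X Y in \<open>simp_all add: T_obj F_xi_mor_closed C.chain_map_id C'.chain_map_id D.id_closed
        F_xi_mor_incl summand_mor_id D.id_left F_incl_closed\<close>)
  then show ?case by (simp add: F_xi_def fun_eq_iff)
next
  case (4 X1 X2 X3 Y1 Y2 Y3 f f' g g')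
  then have [simp]: "inf_complex C X1" "inf_complex C X2" "inf_complex C X3"
    "inf_complex C' Y1" "inf_complex C' Y2" "inf_complex C' Y3"
    "inf_complex_mor C X1 X2 f" "inf_complex_mor C X2 X3 f'"
    "inf_complex_mor C' Y1 Y2 g" "inf_complex_mor C' Y2 Y3 g'" by simp_all
  note [simp] = T_obj F_xi_mor_closed F_incl_closed
  let ?f = "\<lambda>n. Comp C (Term X1 n) (Term X2 n) (Term X3 n) (f' n) (f n)"
  let ?g = "\<lambda>n. Comp C' (Term Y1 n) (Term Y2 n) (Term Y3 n) (g' n) (g n)"
  have [simp]: "inf_complex_mor C X1 X3 ?f" by (rule C.chain_map_comp[where Y = X2]) simp_all
  have [simp]: "inf_complex_mor C' Y1 Y3 ?g" by (rule C'.chain_map_comp[where Y = Y2]) simp_all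
  have "F_xi_mor D F (X1, Y1) (X3, Y3) ?f ?g n =
    Comp D (T X1 Y1 n) (T X2 Y2 n) (T X3 Y3 n) (F_xi_mor D F (X2, Y2) (X3, Y3) f' g' n)
      (F_xi_mor D F (X1, Y1) (X2, Y2) f g n)" for n
  proof (rule tensor_ext[of X1 Y1 "T X3 Y3 n" _ n])
    fix i j assume n: "i + j = n"
    then have "F_incl D F X1 Y1 i j \<in> carrier (Hom D (S X1 Y1 i j) (T X1 Y1 n))" by simp
    then show "Comp D (S X1 Y1 i j) (T X1 Y1 n) (T X3 Y3 n) (F_xi_mor D F (X1, Y1) (X3, Y3) ?f ?g n) (F_incl D F X1 Y1 i j) =
      Comp D (S X1 Y1 i j) (T X1 Y1 n) (T X3 Y3 n) (Comp D (T X1 Y1 n) (T X2 Y2 n) (T X3 Y3 n)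
        (F_xi_mor D F (X2, Y2) (X3, Y3) f' g' n) (F_xi_mor D F (X1, Y1) (X2, Y2) f g n)) (F_incl D F X1 Y1 i j)"
      by (simp add: D.comp_assoc[symmetric] F_xi_mor_incl[OF _ _ _ _ _ _ n] F_xi_mor_summand n)
  qed simp_all
  then show ?case by (simp add: F_xi_def fun_eq_iff)
qed

end

section \<open>Restriction to N-complexes\<close>

theorem theorem3p11:
  fixes R :: "('r, 'x) ring_scheme"
    and C :: "('o1, 'm1, 'r) lincat"
    and C' :: "('o2, 'm2, 'r) lincat"
    and D :: "('o3, 'm3, 'r) lincat"
    and F :: "('o1, 'm1, 'o2, 'm2, 'o3, 'm3) bifunctor"
    and N :: nat
    and \<xi> :: 'r
  assumes "domain R"
    and "additive_linear_category R C"
    and "additive_linear_category R C'"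
    and "additive_linear_category R D"
    and "has_countable_coproducts D"
    and "\<xi> \<in> carrier R"
    and "bilinear_bifunctor R C C' D F"
    and "twisted_Leibniz R D N \<xi>"
  shows "bilinear_bifunctor R (C_inf C) (C_inf C') (C_inf D) (F_xi R \<xi> C C' D F) \<and>
    bilinear_bifunctor R (C_N N C) (C_N N C') (C_N N D) (F_xi R \<xi> C C' D F)"
proof -
  interpret R: domain R by fact
  interpret F: bilinear_bifunctor R C C' D F by fact
  obtain p k e where p: "prime p" and root: "primitive_root R k \<xi>" and N: "N = p ^ e * k"
    and pD: "e = 0 \<or> annihilates p D"
    using R.twisted_Leibniz_cases[OF assms(8)] .
  interpret twisted_tensor R C C' D F \<xi>
    by unfold_locales (use assms(5) R.primitive_root_unit[OF root] in auto)
  have van: "gauss_binomial R \<xi> N m \<odot>\<^bsub>Hom D A B\<^esub> x = \<zero>\<^bsub>Hom D A B\<^esub>"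
    if "A \<in> Obj D" "B \<in> Obj D" "x \<in> carrier (Hom D A B)" "0 < m" "m < N" for A B x m
  proof -
    interpret M: module R "Hom D A B" using that by (simp add: F.D.hom_module)
    have "e = 0 \<or> [p] \<cdot>\<^bsub>Hom D A B\<^esub> x = \<zero>\<^bsub>Hom D A B\<^esub>"
      using pD that by (auto simp: annihilates_def)
    then show ?thesis unfolding N
      using that N by (intro M.gauss_binomial_smult_eq_0[OF assms(1) root p]) simp_all
  qed
  interpret Fxi: bilinear_bifunctor R "C_inf C" "C_inf C'" "C_inf D" "F_xi R \<xi> C C' D F"
    by (rule F_xi_bifunctor)
  have "bilinear_bifunctor R (C_N N C) (C_N N C') (C_N N D) (F_xi R \<xi> C C' D F)"
    unfolding C_N_def
  proof (rule Fxi.restrict)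
    fix X Y
    assume "X \<in> {X \<in> Obj (C_inf C). \<forall>n. iterated_diff C X n N = \<zero>\<^bsub>Hom C (Term X n) (Term X (n + int N))\<^esub>}"
      and "Y \<in> {Y \<in> Obj (C_inf C'). \<forall>n. iterated_diff C' Y n N = \<zero>\<^bsub>Hom C' (Term Y n) (Term Y (n + int N))\<^esub>}"
    then show "FObj (F_xi R \<xi> C C' D F) (X, Y) \<in> {Z \<in> Obj (C_inf D). \<forall>n.
        iterated_diff D Z n N = \<zero>\<^bsub>Hom D (Term Z n) (Term Z (n + int N))\<^esub>}"
      by (simp add: F_xi_def tensor_inf_complex tensor_N_complex van)
  qed auto
  with F_xi_bifunctor show ?thesis ..
qed

end
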